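(* Let $n\geq 1$, let $f:\{0,1\}^n\to\{0,1\}$ be a boolean function and let $p\in(0.5,1]$. Then the following statements are equivalent: (a) $f$ is matchgate-computable with probability at least $p$. (b) $f$ is a linear threshold gate with margin $\epsilon\geq 2p-1$. Moreover, (a) holds if and only if there exists a matchgate circuit acting on at most $n+1$ qubits which computes $f$ with probability at least $p$.
   Context: Matchgates. A matchgate is a two-qubit unitary $G$ whose matrix in the standard basis $|00\rangle,|01\rangle,|10\rangle,|11\rangle$ is $$G=\begin{pmatrix} a & 0 & 0 & b \\ 0 & u & v & 0 \\ 0 & x & y & 0 \\ c & 0 & 0 & d \end{pmatrix},\quad \begin{pmatrix} a & b \\ c & d \end{pmatrix}\in SU(2),\quad \begin{pmatrix} u & v \\ x & y \end{pmatrix}\in SU(2).$$ A matchgate circuit on $m$ qubits (arranged on a line $1,\dots,m$) is a unitary that is a finite product of matchgates, each acting on a pair of nearest-neighbor qubits $(k,k+1)$. Global phases are irrelevant. No bound is placed on the number of gates. Computability. Let $U$ be an $m$-qubit unitary with $m\geq n$. $U$ computes $f$ with probability at least $p$ if for every $x\in\{0,1\}^n$, preparing $U|x,0\rangle$ (where $0$ denotes a string of $m-n$ zeros) and measuring the first qubit in the computational basis yields outcome $f(x)$ with probability at least $p$. $f$ is matchgate-computable with probability at least $p$ if for some $m\geq n$ there is a matchgate circuit on $m$ qubits that computes $f$ with probability at least $p$ (no restriction on the size of $m$). Linear threshold gates. For $x\in\{0,1\}^n$ let $\hat x\in\{\pm1\}^n$ with $\hat x_k=(-1)^{x_k}$.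 $f$ is a linear threshold gate (LTG) if there exist $w\in\mathbb{R}^n$ and $\theta\in\mathbb{R}$ such that $(-1)^{f(x)}=\mathrm{sign}(w^T\hat x+\theta)$ for all $x\in\{0,1\}^n$ (in particular $w^T\hat x+\theta\neq0$ for all $x$); such a pair $(w,\theta)$ is called a representation of $f$. The representation is normalized if $\|w\|_1+|\theta|=1$, where $\|w\|_1=\sum_k|w_k|$. The margin of a representation is $\min_{x}|w^T\hat x+\theta|$ over all $x\in\{0,1\}^n$; the margin $\epsilon$ of the LTG $f$ is the maximum of the margins of its normalized representations. *)

theory Defs
  imports
    "Jordan_Normal_Form.Determinant"
    "Jordan_Normal_Form.Schur_Decomposition"
begin

definition kron :: "complex mat \<Rightarrow> complex mat \<Rightarrow> complex mat" where
  "kron A B = mat (dim_row A * dim_row B) (dim_col A * dim_col B)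
     (\<lambda>(i, j). A $$ (i div dim_row B, j div dim_col B) * B $$ (i mod dim_row B, j mod dim_col B))"

(* A bit string lists the qubits from left to right, so its first bit is the most significant
   digit of the index; this makes ket (x @ y) the tensor product (in the order of kron)
   of ket x and ket y, and orders the two-qubit basis as 00, 01, 10, 11. *)

definition basis_index :: "bool list \<Rightarrow> nat" where
  "basis_index x = horner_sum of_bool 2 (rev x)"

definition ket :: "bool list \<Rightarrow> complex vec" where
  "ket x = unit_vec (2 ^ length x) (basis_index x)"

definition unitary_mat :: "nat \<Rightarrow> complex mat \<Rightarrow> bool" where
  "unitary_mat N A \<longleftrightarrow> A \<in> carrier_mat N N \<and> mat_adjoint A * A = 1\<^sub>m N"

definition SU2 :: "complex mat set" where
  "SU2 = {A. unitary_mat 2 A \<and> det A = 1}"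

(* Such a G is automatically unitary. *)

definition is_matchgate :: "complex mat \<Rightarrow> bool" where
  "is_matchgate G \<longleftrightarrow> (\<exists>a b c d u v x y.
     mat_of_rows_list 2 [[a, b], [c, d]] \<in> SU2 \<and>
     mat_of_rows_list 2 [[u, v], [x, y]] \<in> SU2 \<and>
     G = mat_of_rows_list 4 [[a, 0, 0, b],
                             [0, u, v, 0],
                             [0, x, y, 0],
                             [c, 0, 0, d]])"

(* The qubits are numbered 0, ..., m - 1; the two-qubit gate G acts on the qubits k and k + 1. *)

definition gate_at :: "nat \<Rightarrow> nat \<Rightarrow> complex mat \<Rightarrow> complex mat" where
  "gate_at m k G = kron (kron (1\<^sub>m (2 ^ k)) G) (1\<^sub>m (2 ^ (m - k - 2)))"

(* Global phases are not added to the set of circuits: they do not change any outcome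
   probability. *)

inductive matchgate_circuit :: "nat \<Rightarrow> complex mat \<Rightarrow> bool" for m :: nat where
  empty: "matchgate_circuit m (1\<^sub>m (2 ^ m))"
| gate: "matchgate_circuit m U \<Longrightarrow> is_matchgate G \<Longrightarrow> k + 1 < m
    \<Longrightarrow> matchgate_circuit m (gate_at m k G * U)"

definition prob_first_qubit :: "nat \<Rightarrow> complex vec \<Rightarrow> bool \<Rightarrow> real" where
  "prob_first_qubit m \<psi> b =
     (\<Sum>y | length y = m \<and> hd y = b. (cmod (\<psi> $ basis_index y))\<^sup>2)"

(* Boolean functions on n bits are functions on bool list that are only ever applied to lists
   of length n. *)

definition computes_with_prob ::
    "nat \<Rightarrow> nat \<Rightarrow> complex mat \<Rightarrow> (bool list \<Rightarrow> bool) \<Rightarrow> real \<Rightarrow> bool" where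
  "computes_with_prob n m U f p \<longleftrightarrow>
     (\<forall>x. length x = n \<longrightarrow>
        prob_first_qubit m (U *\<^sub>v ket (x @ replicate (m - n) False)) (f x) \<ge> p)"

definition matchgate_computable :: "nat \<Rightarrow> (bool list \<Rightarrow> bool) \<Rightarrow> real \<Rightarrow> bool" where
  "matchgate_computable n f p \<longleftrightarrow>
     (\<exists>m\<ge>n. \<exists>U. matchgate_circuit m U \<and> computes_with_prob n m U f p)"

definition spin :: "bool \<Rightarrow> real" where
  "spin b = (- 1) ^ (of_bool b :: nat)"

(* Weight vectors are functions on nat of which only the values at 0, ..., n - 1 are used. *)

definition affine_form :: "nat \<Rightarrow> (nat \<Rightarrow> real) \<Rightarrow> real \<Rightarrow> bool list \<Rightarrow> real" where
  "affine_form n w \<theta> x = (\<Sum>k<n. w k * spin (x ! k)) + \<theta>"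

(* Since sgn 0 = 0, the affine form does not vanish on bit strings of length n. *)

definition ltg_representation ::
    "nat \<Rightarrow> (bool list \<Rightarrow> bool) \<Rightarrow> (nat \<Rightarrow> real) \<Rightarrow> real \<Rightarrow> bool" where
  "ltg_representation n f w \<theta> \<longleftrightarrow>
     (\<forall>x. length x = n \<longrightarrow> spin (f x) = sgn (affine_form n w \<theta> x))"

definition is_ltg :: "nat \<Rightarrow> (bool list \<Rightarrow> bool) \<Rightarrow> bool" where
  "is_ltg n f \<longleftrightarrow> (\<exists>w \<theta>. ltg_representation n f w \<theta>)"

definition normalized :: "nat \<Rightarrow> (nat \<Rightarrow> real) \<Rightarrow> real \<Rightarrow> bool" where
  "normalized n w \<theta> \<longleftrightarrow> (\<Sum>k<n. \<bar>w k\<bar>) + \<bar>\<theta>\<bar> = 1"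

definition representation_margin :: "nat \<Rightarrow> (nat \<Rightarrow> real) \<Rightarrow> real \<Rightarrow> real" where
  "representation_margin n w \<theta> = (MIN x\<in>{x. length x = n}. \<bar>affine_form n w \<theta> x\<bar>)"

(* Meaningful only if is_ltg n f; then the maximum exists by compactness. *)

definition ltg_margin :: "nat \<Rightarrow> (bool list \<Rightarrow> bool) \<Rightarrow> real" where
  "ltg_margin n f = (GREATEST \<epsilon>. \<exists>w \<theta>. ltg_representation n f w \<theta> \<and> normalized n w \<theta> \<and>
     \<epsilon> = representation_margin n w \<theta>)"

end

theory Submission
  imports Defs "HOL-Analysis.Function_Topology"
begin

text \<open>In the Heisenberg picture a matchgate circuit \<open>U\<close> maps each real linear combination of the Majorana
  operators \<open>Z \<dots> Z X I \<dots> I\<close> and \<open>Z \<dots> Z Y I \<dots> I\<close> to another one, of the same norm. Since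
  \<open>Z\<close> on the first qubit is \<open>- \<i>\<close> times the product of two of them, the expectation of
  \<open>U\<^sup>\<dagger> Z\<^sub>1 U\<close> in the basis state \<open>x\<close> is an affine form \<open>\<Sum>\<^sub>k w\<^sub>k (-1)\<^bsup>x\<^sub>k\<^esup>\<close> with
  \<open>\<Sum>\<^sub>k \<bar>w\<^sub>k\<bar> \<le> 1\<close>, the ancillas contributing the threshold. Conversely, all such weights are realised
  (on at least two qubits) by a cascade of matchgates on the pairs \<open>(k, k + 1)\<close>, and one ancilla is enough
  for the threshold.\<close>

section \<open>Kronecker products and basis states\<close>

text \<open>Outcome b on the first qubit has probability \<open>(1 + spin b * E) / 2\<close>, where
  E is the expectation of Z there. Success with probability at least p therefore says that
  \<open>spin (f x) * E\<close> is at least 2p - 1; this is the origin of the margin, and p > 1/2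
  makes the sign of E correct. The bound on the weights comes from norms: the two Majorana factors
  of Z evolve into unit vectors with complex coordinates z_k and w_k, the k-th weight is the
  imaginary part of z_k times the conjugate of w_k, and the arithmetic-geometric inequality applies.
  In the converse only diagonal entries of the evolved observable matter, so the cascade need not
  control the others. A single qubit admits no gate at all, hence the restriction to two qubits,
  which n >= 1 and one ancilla satisfy. Since the margin is defined as a greatest element, it has to
  be shown to exist. Normalized representations need not form a closed set, so the maximum is taken
  over the compact sphere of all normalized weight vectors.\<close>

lemma mat_adjoint_dims [simp]:
  "dim_row (mat_adjoint A) = dim_col A" "dim_col (mat_adjoint A) = dim_row A"
  by (simp_all add: mat_adjoint_def)

lemma mat_adjoint_carrier [simp, intro]:
  "A \<in> carrier_mat m n \<Longrightarrow> mat_adjoint A \<in> carrier_mat n m"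
  by (intro carrier_matI) auto

lemma mat_adjoint_index [simp]:
  fixes A :: "complex mat"
  assumes "i < dim_col A" "j < dim_row A"
  shows "mat_adjoint A $$ (i, j) = cnj (A $$ (j, i))"
  using assms by (simp add: mat_adjoint_def mat_of_rows_def)

lemma mat_adjoint_mult:
  fixes A B :: "complex mat"
  assumes "A \<in> carrier_mat m n" "B \<in> carrier_mat n k"
  shows "mat_adjoint (A * B) = mat_adjoint B * mat_adjoint A"
proof (rule eq_matI)
  show "mat_adjoint (A * B) $$ (i, j) = (mat_adjoint B * mat_adjoint A) $$ (i, j)"
    if "i < dim_row (mat_adjoint B * mat_adjoint A)" "j < dim_col (mat_adjoint B * mat_adjoint A)" for i j
    using that assms by (auto simp: scalar_prod_def mult.commute)
qed (use assms in auto)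

lemma mat_adjoint_one [simp]: "mat_adjoint (1\<^sub>m n :: complex mat) = 1\<^sub>m n"
  by (rule eq_matI) auto

lemma kron_dims [simp]:
  "dim_row (kron A B) = dim_row A * dim_row B" "dim_col (kron A B) = dim_col A * dim_col B"
  by (simp_all add: kron_def)

lemma kron_carrier [simp, intro]:
  "A \<in> carrier_mat a b \<Longrightarrow> B \<in> carrier_mat c d \<Longrightarrow> kron A B \<in> carrier_mat (a * c) (b * d)"
  by (intro carrier_matI) auto

lemma kron_index [simp]:
  "i < dim_row A * dim_row B \<Longrightarrow> j < dim_col A * dim_col B \<Longrightarrow> kron A B $$ (i, j) =
    A $$ (i div dim_row B, j div dim_col B) * B $$ (i mod dim_row B, j mod dim_col B)"
  by (simp add: kron_def)

lemma div_mod_less_mult: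
  fixes i a b :: nat
  assumes "i < a * b"
  shows "i div b < a" "i mod b < b"
proof -
  from assms have "0 < b" by (cases "b = 0") auto
  then show "i mod b < b" by simp
  from assms show "i div b < a" by (rule less_mult_imp_div_less)
qed

text \<open>Entrywise proofs about \<open>kron\<close> need bounds on the quotient and remainder of
  each index; this rule supplies them once for the adjoint and linearity laws below.\<close>

lemma eq_mat_div_modI:
  assumes "dim_row M' = a * c" "dim_col M' = b * d" "dim_row M = a * c" "dim_col M = b * d"
    and "\<And>i j. i < a * c \<Longrightarrow> j < b * d \<Longrightarrow> i div c < a \<Longrightarrow> i mod c < c \<Longrightarrow> j div d < b \<Longrightarrow> j mod d < d
      \<Longrightarrow> M $$ (i, j) = M' $$ (i, j)"
  shows "M = M'"
  using assms by (intro eq_matI) (simp_all add: div_mod_less_mult(1) div_mod_less_mult(2)[of _ a] div_mod_less_mult(2)[of _ b])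

lemma sum_div_mod:
  fixes g :: "nat \<Rightarrow> nat \<Rightarrow> complex"
  shows "(\<Sum>i = 0..<a * b. g (i div b) (i mod b)) = (\<Sum>i = 0..<a. \<Sum>j = 0..<b. g i j)"
proof -
  have "(\<Sum>i = 0..<a * b. g (i div b) (i mod b)) = 
     (\<Sum>m<a. \<Sum>i = m * b..<m * b + b. g (i div b) (i mod b))"
    using sum.nat_group[of "\<lambda>i. g (i div b) (i mod b)" b a] by (simp add: lessThan_atLeast0)
  also have "\<dots> = (\<Sum>m<a. \<Sum>i = 0..<b. g m i)"
  proof (rule sum.cong)
    fix m
    have "(\<Sum>i = m * b..<m * b + b. g (i div b) (i mod b)) = 
      (\<Sum>i = 0..<b. g ((i + m * b) div b) ((i + m * b) mod b))"
      using sum.shift_bounds_nat_ivl[of "\<lambda>i. g (i div b) (i mod b)" 0 "m * b" b] by (simp add: add.commute)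
    then show "(\<Sum>i = m * b..<m * b + b. g (i div b) (i mod b)) = (\<Sum>i = 0..<b. g m i)"
      by simp
  qed simp
  finally show ?thesis by (simp add: lessThan_atLeast0)
qed

text \<open>The mixed-product rule: splitting the summation index into quotient and remainder
  factors the sum into one sum for each tensor factor.\<close>

lemma kron_mult:
  assumes "A \<in> carrier_mat a b" "C \<in> carrier_mat b c" "B \<in> carrier_mat a' b'" "D \<in> carrier_mat b' c'"
  shows "kron A B * kron C D = kron (A * C) (B * D)"
proof (rule eq_matI)
  fix i j assume "i < dim_row (kron (A * C) (B * D))" "j < dim_col (kron (A * C) (B * D))"
  then have ij: "i < a * a'" "j < c * c'" using assms by auto
  have "(kron A B * kron C D) $$ (i, j) = (\<Sum>k = 0..<b * b'. 
      (A $$ (i div a', k div b') * B $$ (i mod a', k mod b')) * 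
      (C $$ (k div b', j div c') * D $$ (k mod b', j mod c')))"
    using ij assms by (auto simp: scalar_prod_def)
  also have "\<dots> = (\<Sum>k = 0..<b. \<Sum>l = 0..<b'. (A $$ (i div a', k) * B $$ (i mod a', l)) * 
      (C $$ (k, j div c') * D $$ (l, j mod c')))"
    by (rule sum_div_mod)
  also have "\<dots> = (\<Sum>k = 0..<b. A $$ (i div a', k) * C $$ (k, j div c')) * 
      (\<Sum>l = 0..<b'. B $$ (i mod a', l) * D $$ (l, j mod c'))"
    by (simp add: sum_product mult_ac)
  also have "\<dots> = kron (A * C) (B * D) $$ (i, j)"
    using ij assms div_mod_less_mult[OF ij(1)] div_mod_less_mult[OF ij(2)]
    by (auto simp: scalar_prod_def)
  finally show "(kron A B * kron C D) $$ (i, j) = kron (A * C) (B * D) $$ (i, j)" .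
qed (use assms in auto)

lemma kron_assoc: "kron (kron A B) C = kron A (kron B C)"
proof (rule eq_matI)
  fix i j assume "i < dim_row (kron A (kron B C))" "j < dim_col (kron A (kron B C))"
  then have ij: "i < dim_row A * dim_row B * dim_row C" "j < dim_col A * dim_col B * dim_col C"
    by (simp_all add: mult.assoc)
  \<comment> \<open>Both bracketings read an index as the same three mixed-radix digits.\<close>
  have *: "k div c mod b = k mod (b * c) div c" "k mod (b * c) mod c = k mod c"
    "k div c div b = k div (b * c)" for k b c :: nat
    by (cases "c = 0"; simp add: mult.commute[of b] mod_mult2_eq div_mult2_eq)+
  show "kron (kron A B) C $$ (i, j) = kron A (kron B C) $$ (i, j)"
    using ij div_mod_less_mult[OF ij(1)] div_mod_less_mult[OF ij(2)]
      div_mod_less_mult[of i "dim_row A" "dim_row B * dim_row C"]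
      div_mod_less_mult[of j "dim_col A" "dim_col B * dim_col C"]
    by (simp add: mult.assoc *)
qed (simp_all add: mult.assoc)

lemma kron_one [simp]: "kron (1\<^sub>m a) (1\<^sub>m b) = 1\<^sub>m (a * b)"
proof (rule eq_matI)
  fix i j assume "i < dim_row (1\<^sub>m (a * b) :: complex mat)" "j < dim_col (1\<^sub>m (a * b) :: complex mat)"
  then have ij: "i < a * b" "j < a * b" by simp_all
  have "i = j \<longleftrightarrow> i div b = j div b \<and> i mod b = j mod b"
    by (metis div_mult_mod_eq)
  then show "kron (1\<^sub>m a) (1\<^sub>m b) $$ (i, j) = 1\<^sub>m (a * b) $$ (i, j)"
    using ij div_mod_less_mult[OF ij(1)] div_mod_less_mult[OF ij(2)] by auto
qed auto

lemma kron_one_one [simp]: "kron (1\<^sub>m (Suc 0)) B = B"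
  by (rule eq_matI) auto

lemma mat_adjoint_kron: "mat_adjoint (kron A B) = kron (mat_adjoint A) (mat_adjoint B)"
  by (rule eq_mat_div_modI[of _ "dim_col A" "dim_col B" "dim_row A" "dim_row B"]) auto

lemma kron_add_left:
  "A \<in> carrier_mat a b \<Longrightarrow> A' \<in> carrier_mat a b \<Longrightarrow> kron (A + A') B = kron A B + kron A' B"
  by (rule eq_mat_div_modI[of _ "dim_row A" "dim_row B" "dim_col A" "dim_col B"]) (auto simp: algebra_simps)

lemma kron_add_right:
  "B \<in> carrier_mat a b \<Longrightarrow> B' \<in> carrier_mat a b \<Longrightarrow> kron A (B + B') = kron A B + kron A B'"
  by (rule eq_mat_div_modI[of _ "dim_row A" "dim_row B" "dim_col A" "dim_col B"]) (auto simp: algebra_simps)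

lemma kron_zero_right [simp]: "kron A (0\<^sub>m a b) = 0\<^sub>m (dim_row A * a) (dim_col A * b)"
  by (rule eq_mat_div_modI[of _ "dim_row A" "a" "dim_col A" "b"]) auto

lemma kron_zero_left [simp]: "kron (0\<^sub>m a b) B = 0\<^sub>m (a * dim_row B) (b * dim_col B)"
  by (rule eq_mat_div_modI[of _ "a" "dim_row B" "b" "dim_col B"]) auto

lemma kron_smult_left: "kron (c \<cdot>\<^sub>m A) B = c \<cdot>\<^sub>m kron A B"
  by (rule eq_mat_div_modI[of _ "dim_row A" "dim_row B" "dim_col A" "dim_col B"]) auto

lemma kron_smult_right: "kron A (c \<cdot>\<^sub>m B) = c \<cdot>\<^sub>m kron A B"
  by (rule eq_mat_div_modI[of _ "dim_row A" "dim_row B" "dim_col A" "dim_col B"]) auto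

section \<open>Binary indices of bit strings\<close>

lemma basis_index_Nil [simp]: "basis_index [] = 0"
  by (simp add: basis_index_def)

lemma basis_index_Cons: "basis_index (b # x) = of_bool b * 2 ^ length x + basis_index x"
  by (simp add: basis_index_def horner_sum_append)

lemma basis_index_less: "basis_index x < 2 ^ length x"
  unfolding basis_index_def using horner_sum_bound[of "rev x"] by simp

lemma basis_index_less' [simp]: "length x = m \<Longrightarrow> basis_index x < 2 ^ m"
  using basis_index_less by blast

lemma kron_index_Cons:
  assumes "A \<in> carrier_mat 2 2" "B \<in> carrier_mat (2 ^ m) (2 ^ m)" "length x = m" "length y = m"
  shows "kron A B $$ (basis_index (b # x), basis_index (c # y)) =
    A $$ (of_bool b, of_bool c) * B $$ (basis_index x, basis_index y)"
  using assms basis_index_less'[of "b # x" "Suc m"] basis_index_less'[of "c # y" "Suc m"]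
  by (auto simp: basis_index_Cons)

lemma bij_betw_basis_index: "bij_betw basis_index {y. length y = m} {..<2 ^ m}"
proof -
  have *: "inj_on basis_index {y. length y = m}"
  proof (rule inj_onI)
    show "x = y" if "x \<in> {y. length y = m}" "y \<in> {y. length y = m}" "basis_index x = basis_index y" for x y
      using that
    proof (induction m arbitrary: x y)
      case (Suc m)
      then obtain b x' c y' where xy: "x = b # x'" "y = c # y'" "length x' = m" "length y' = m"
        by (auto simp: length_Suc_conv)
      \<comment> \<open>The tails stay below the place value of the first bit, so equal indices
        force equal first bits.\<close>
      have "basis_index x' < 2 ^ m" "basis_index y' < 2 ^ m" using xy by simp_all
      with Suc.prems xy have "b = c \<and> basis_index x' = basis_index y'"
        by (cases b; cases c) (auto simp: basis_index_Cons)
      with Suc.IH xy show ?case by simp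
    qed simp
  qed
  have c: "card {y :: bool list. length y = m} = 2 ^ m"
    using card_lists_length_eq[of "UNIV :: bool set" m] by simp
  have "basis_index ` {y. length y = m} = {..<2 ^ m}"
    by (rule card_subset_eq) (auto simp: card_image[OF *] c)
  with * show ?thesis by (simp add: bij_betw_def)
qed

section \<open>Matchgates as \<open>4 \<times> 4\<close> matrices\<close>

abbreviation mat2 :: "complex \<Rightarrow> complex \<Rightarrow> complex \<Rightarrow> complex \<Rightarrow> complex mat" where
  "mat2 a b c d \<equiv> mat_of_rows_list 2 [[a, b], [c, d]]"

lemma eq_mat2I:
  assumes "dim_row A = 2" "dim_col A = 2" "dim_row B = 2" "dim_col B = 2"
    and "\<And>i j. i \<in> {0, 1} \<Longrightarrow> j \<in> {0, 1} \<Longrightarrow> A $$ (i, j) = B $$ (i, j)"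
  shows "A = B"
proof (rule eq_matI)
  show "A $$ (i, j) = B $$ (i, j)" if "i < dim_row B" "j < dim_col B" for i j
  proof -
    have "i \<in> {0, 1}" "j \<in> {0, 1}" using that assms(3,4) by auto
    then show ?thesis by (rule assms(5))
  qed
qed (use assms in auto)

lemma eq_mat4I:
  assumes "dim_row A = 4" "dim_col A = 4" "dim_row B = 4" "dim_col B = 4"
    and "\<And>i j. i \<in> {0, 1, 2, 3} \<Longrightarrow> j \<in> {0, 1, 2, 3} \<Longrightarrow> A $$ (i, j) = B $$ (i, j)"
  shows "A = B"
proof (rule eq_matI)
  show "A $$ (i, j) = B $$ (i, j)" if "i < dim_row B" "j < dim_col B" for i j
  proof -
    have "i \<in> {0, 1, 2, 3}" "j \<in> {0, 1, 2, 3}" using that assms(3,4) by auto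
    then show ?thesis by (rule assms(5))
  qed
qed (use assms in auto)

lemma mat_of_rows_list_dims [simp]:
  "dim_row (mat_of_rows_list n rs) = length rs" "dim_col (mat_of_rows_list n rs) = n"
  by (simp_all add: mat_of_rows_list_def)

lemma mat_of_rows_list_index [simp]:
  "i < length rs \<Longrightarrow> j < n \<Longrightarrow> mat_of_rows_list n rs $$ (i, j) = rs ! i ! j"
  by (simp add: mat_of_rows_list_def)

lemma mat2_carrier: "mat2 a b c d \<in> carrier_mat 2 2"
  by (intro carrier_matI) simp_all

lemma mat2_mult: "mat2 a b c d * mat2 a' b' c' d' =
    mat2 (a * a' + b * c') (a * b' + b * d') (c * a' + d * c') (c * b' + d * d')"
  by (rule eq_mat2I) (auto simp: scalar_prod_def numeral_eq_Suc)

lemma mat2_add: "mat2 a b c d + mat2 a' b' c' d' = mat2 (a + a') (b + b') (c + c') (d + d')"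
  by (rule eq_mat2I) (auto simp: numeral_eq_Suc)

lemma mat2_smult: "x \<cdot>\<^sub>m mat2 a b c d = mat2 (x * a) (x * b) (x * c) (x * d)"
  by (rule eq_mat2I) (auto simp: numeral_eq_Suc)

lemma mat2_adjoint: "mat_adjoint (mat2 a b c d) = mat2 (cnj a) (cnj c) (cnj b) (cnj d)"
  by (rule eq_mat2I) (auto simp: numeral_eq_Suc)

lemma mat2_one: "1\<^sub>m 2 = mat2 1 0 0 1"
  by (rule eq_mat2I) (auto simp: numeral_eq_Suc)

lemma mat4_mult:
  "mat_of_rows_list 4 [[a11, a12, a13, a14], [a21, a22, a23, a24], [a31, a32, a33, a34], [a41, a42, a43, a44]] *
   mat_of_rows_list 4 [[b11, b12, b13, b14], [b21, b22, b23, b24], [b31, b32, b33, b34], [b41, b42, b43, b44]] =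
   mat_of_rows_list 4
    [[a11 * b11 + a12 * b21 + a13 * b31 + a14 * b41, a11 * b12 + a12 * b22 + a13 * b32 + a14 * b42,
      a11 * b13 + a12 * b23 + a13 * b33 + a14 * b43, a11 * b14 + a12 * b24 + a13 * b34 + a14 * b44],
     [a21 * b11 + a22 * b21 + a23 * b31 + a24 * b41, a21 * b12 + a22 * b22 + a23 * b32 + a24 * b42,
      a21 * b13 + a22 * b23 + a23 * b33 + a24 * b43, a21 * b14 + a22 * b24 + a23 * b34 + a24 * b44],
     [a31 * b11 + a32 * b21 + a33 * b31 + a34 * b41, a31 * b12 + a32 * b22 + a33 * b32 + a34 * b42,
      a31 * b13 + a32 * b23 + a33 * b33 + a34 * b43, a31 * b14 + a32 * b24 + a33 * b34 + a34 * b44],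
     [a41 * b11 + a42 * b21 + a43 * b31 + a44 * b41, a41 * b12 + a42 * b22 + a43 * b32 + a44 * b42,
      a41 * b13 + a42 * b23 + a43 * b33 + a44 * b43, a41 * b14 + a42 * b24 + a43 * b34 + (a44 * b44 :: complex)]]"
  by (rule eq_mat4I) (auto simp: scalar_prod_def numeral_eq_Suc)

lemma mat4_add:
  "mat_of_rows_list 4 [[a11, a12, a13, a14], [a21, a22, a23, a24], [a31, a32, a33, a34], [a41, a42, a43, a44]] +
   mat_of_rows_list 4 [[b11, b12, b13, b14], [b21, b22, b23, b24], [b31, b32, b33, b34], [b41, b42, b43, b44]] =
   mat_of_rows_list 4
    [[a11 + b11, a12 + b12, a13 + b13, a14 + b14], [a21 + b21, a22 + b22, a23 + b23, a24 + b24],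
     [a31 + b31, a32 + b32, a33 + b33, a34 + b34], [a41 + b41, a42 + b42, a43 + b43, a44 + (b44 :: complex)]]"
  by (rule eq_mat4I) (auto simp: numeral_eq_Suc)

lemma kron_mat2: "kron (mat2 a b c d) (mat2 a' b' c' d') = mat_of_rows_list 4
    [[a * a', a * b', b * a', b * b'], [a * c', a * d', b * c', b * d'],
     [c * a', c * b', d * a', d * b'], [c * c', c * d', d * c', d * d']]"
  by (rule eq_mat4I) (auto simp flip: numeral_2_eq_2)

lemma mat4_one: "1\<^sub>m 4 = mat_of_rows_list 4 [[1, 0, 0, 0], [0, 1, 0, 0], [0, 0, 1, 0], [0, 0, 0, 1 :: complex]]"
  by (rule eq_mat4I) (auto simp: numeral_eq_Suc)

text \<open>Normal form of a matchgate: a matrix in SU(2) is determined by its first row, so two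
  rows of two complex numbers suffice.\<close>

definition mgate :: "complex \<Rightarrow> complex \<Rightarrow> complex \<Rightarrow> complex \<Rightarrow> complex mat" where
  "mgate a b u v = mat_of_rows_list 4
     [[a, 0, 0, b], [0, u, v, 0], [0, - cnj v, cnj u, 0], [- cnj b, 0, 0, cnj a]]"

lemma mgate_carrier [simp]: "mgate a b u v \<in> carrier_mat 4 4"
  by (intro carrier_matI) (auto simp: mgate_def)

lemma mgate_adjoint: "mat_adjoint (mgate a b u v) = mgate (cnj a) (- b) (cnj u) (- v)"
  unfolding mgate_def by (rule eq_mat4I) (auto simp: numeral_eq_Suc)

lemma SU2_mat2_iff:
  "mat2 a b c d \<in> SU2 \<longleftrightarrow> c = - cnj b \<and> d = cnj a \<and> a * cnj a + b * cnj b = 1"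
proof -
  have det: "det (mat2 a b c d) = a * d - b * c"
  proof -
    have "det (mat2 a b c d) = (\<Sum>i<2. mat2 a b c d $$ (i, 0) * cofactor (mat2 a b c d) i 0)"
      by (rule laplace_expansion_column[OF mat2_carrier]) simp
    moreover have "cofactor (mat2 a b c d) 0 0 = d" "cofactor (mat2 a b c d) (Suc 0) 0 = - b"
      by (simp_all add: cofactor_def mat_delete_def det_single carrier_matI)
    ultimately show ?thesis by (simp add: numeral_2_eq_2)
  qed
  have eq: "mat2 x y z w = mat2 1 0 0 1 \<longleftrightarrow> x = 1 \<and> y = 0 \<and> z = 0 \<and> w = 1" for x y z w
  proof
    assume "mat2 x y z w = mat2 1 0 0 1"
    then have "mat2 x y z w $$ (i, j) = mat2 1 0 0 1 $$ (i, j)" for i j by simp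
    from this[of 0 0] this[of 0 1] this[of 1 0] this[of 1 1] show "x = 1 \<and> y = 0 \<and> z = 0 \<and> w = 1"
      by simp
  qed simp
  have iff: "mat2 a b c d \<in> SU2 \<longleftrightarrow> cnj a * a + cnj c * c = 1 \<and> cnj a * b + cnj c * d = 0 \<and>
      cnj b * a + cnj d * c = 0 \<and> cnj b * b + cnj d * d = 1 \<and> a * d - b * c = 1"
    unfolding SU2_def unitary_mat_def mat2_one
    by (simp only: mem_Collect_eq det mat2_adjoint mat2_mult eq mat2_carrier simp_thms conj_assoc)
  show ?thesis
  proof
    assume "mat2 a b c d \<in> SU2"
    then have h: "cnj a * a + cnj c * c = 1" "cnj a * b + cnj c * d = 0" "a * d - b * c = 1"
      using iff by auto
    \<comment> \<open>Adjoint and adjugate are both the inverse of the matrix; these combinations of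
      the unitarity and determinant equations compare the two.\<close>
    have "d = d * (cnj a * a + cnj c * c)" using h by simp
    also have "\<dots> = cnj a * (a * d - b * c) + c * (cnj a * b + cnj c * d)"
      by (simp add: algebra_simps)
    finally have "d = cnj a" using h by simp
    have "cnj c = cnj c * (a * d - b * c)" using h by simp
    also have "\<dots> = a * (cnj a * b + cnj c * d) - b * (cnj a * a + cnj c * c)"
      by (simp add: algebra_simps)
    finally have "cnj c = - b" using h by simp
    then have "c = - cnj b" by (metis complex_cnj_cnj complex_cnj_minus)
    with \<open>d = cnj a\<close> show "c = - cnj b \<and> d = cnj a \<and> a * cnj a + b * cnj b = 1"
      using h by (simp add: mult.commute)
  next
    assume "c = - cnj b \<and> d = cnj a \<and> a * cnj a + b * cnj b = 1"
    then show "mat2 a b c d \<in> SU2"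
      unfolding iff by (auto simp: algebra_simps)
  qed
qed

lemma is_matchgate_iff: "is_matchgate G \<longleftrightarrow>
    (\<exists>a b u v. a * cnj a + b * cnj b = 1 \<and> u * cnj u + v * cnj v = 1 \<and> G = mgate a b u v)"
  unfolding is_matchgate_def SU2_mat2_iff mgate_def by blast

lemma matchgate_carrier: "is_matchgate G \<Longrightarrow> G \<in> carrier_mat 4 4"
  by (auto simp: is_matchgate_iff)

lemma matchgate_unitary: "is_matchgate G \<Longrightarrow> mat_adjoint G * G = 1\<^sub>m 4"
  by (auto simp: is_matchgate_iff mgate_adjoint) (simp add: mgate_def mat4_mult mat4_one algebra_simps)

section \<open>Conjugation of Pauli products by a matchgate\<close>

definition pauli_Z :: "complex mat" where
  "pauli_Z = mat2 1 0 0 (- 1)"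

text \<open>\<open>equatorial (r - \<i> s)\<close> is the real combination \<open>r X + s Y\<close> of Pauli matrices.\<close>

definition equatorial :: "complex \<Rightarrow> complex mat" where
  "equatorial z = mat2 0 z (cnj z) 0"

lemma pauli_carrier [simp]:
  "pauli_Z \<in> carrier_mat 2 2" "equatorial z \<in> carrier_mat 2 2"
  by (intro carrier_matI; simp add: pauli_Z_def equatorial_def)+

lemma pauli_dims [simp]:
  "dim_row pauli_Z = 2" "dim_col pauli_Z = 2" "dim_row (equatorial z) = 2" "dim_col (equatorial z) = 2"
  by (auto simp: pauli_Z_def equatorial_def)

text \<open>The product of both Z is the parity: 1 on the span of 00 and 11, -1 on the span of 01
  and 10. A matchgate is unitary on each of these spans.\<close>

lemma matchgate_conj_ZZ:
  assumes "is_matchgate G"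
  shows "mat_adjoint G * (kron pauli_Z pauli_Z * G) = kron pauli_Z pauli_Z"
proof -
  from assms obtain a b u v where G: "a * cnj a + b * cnj b = 1" "u * cnj u + v * cnj v = 1" "G = mgate a b u v"
    by (auto simp: is_matchgate_iff)
  let ?p = "a * cnj a + b * cnj b" and ?q = "u * cnj u + v * cnj v"
  have "mat_adjoint G * (kron pauli_Z pauli_Z * G) =
      mat_of_rows_list 4 [[?p, 0, 0, 0], [0, - ?q, 0, 0], [0, 0, - ?q, 0], [0, 0, 0, ?p]]"
    unfolding G(3) mgate_adjoint
    by (simp add: mgate_def pauli_Z_def kron_mat2 mat4_mult algebra_simps)
  then show ?thesis
    unfolding G(1,2) by (simp add: pauli_Z_def kron_mat2)
qed

text \<open>Such a combination exchanges the even and the odd span. Its block from odd to even has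
  rows (w, z) and (cnj z, - cnj w), which is a quaternion with the second row negated.
  Multiplication by the two SU(2) blocks of \<open>G\<close> preserves this form, and
  \<open>w'\<close>, \<open>z'\<close> are the first row of the product.\<close>

lemma matchgate_conj_majorana2:
  assumes "is_matchgate G"
  shows "\<exists>z' w'. mat_adjoint G * ((kron (equatorial z) (1\<^sub>m 2) + kron pauli_Z (equatorial w)) * G) =
    kron (equatorial z') (1\<^sub>m 2) + kron pauli_Z (equatorial w')"
proof -
  from assms obtain a b u v where G: "G = mgate a b u v"
    by (auto simp: is_matchgate_iff)
  define w' where "w' = (cnj a * w - b * cnj z) * u - cnj v * (cnj a * z + b * cnj w)"
  define z' where "z' = (cnj a * w - b * cnj z) * v + cnj u * (cnj a * z + b * cnj w)"
  have "mat_adjoint G * ((kron (equatorial z) (1\<^sub>m 2) + kron pauli_Z (equatorial w)) * G) =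
    kron (equatorial z') (1\<^sub>m 2) + kron pauli_Z (equatorial w')"
    unfolding G mgate_adjoint
    by (simp add: mgate_def pauli_Z_def equatorial_def mat2_one kron_mat2 mat4_mult mat4_add
        z'_def w'_def algebra_simps)
  then show ?thesis by blast
qed

section \<open>Circuits and outcome probabilities\<close>

lemma gate_at_0: "gate_at m 0 G = kron G (1\<^sub>m (2 ^ (m - 2)))"
  by (simp add: gate_at_def)

text \<open>The inductions on the number of qubits split off the first qubit, on which a gate
  further to the right acts as the identity.\<close>

lemma gate_at_Suc:
  assumes "G \<in> carrier_mat 4 4"
  shows "gate_at (Suc m) (Suc k) G = kron (1\<^sub>m 2) (gate_at m k G)"
proof -
  have "gate_at (Suc m) (Suc k) G = kron (kron (kron (1\<^sub>m 2) (1\<^sub>m (2 ^ k))) G) (1\<^sub>m (2 ^ (m - k - 2)))"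
    by (simp add: gate_at_def)
  then show ?thesis by (simp only: gate_at_def kron_assoc)
qed

lemma gate_at_dim:
  assumes "k + 1 < m"
  shows "2 ^ k * 4 * 2 ^ (m - k - 2) = (2 :: nat) ^ m"
proof -
  have "k + 2 + (m - k - 2) = m" using assms by simp
  then have "(2 :: nat) ^ m = 2 ^ (k + 2 + (m - k - 2))" by (simp only:)
  also have "\<dots> = 2 ^ k * 2 ^ 2 * 2 ^ (m - k - 2)" by (simp only: power_add)
  finally show ?thesis by simp
qed

lemma gate_at_carrier:
  assumes "G \<in> carrier_mat 4 4" "k + 1 < m"
  shows "gate_at m k G \<in> carrier_mat (2 ^ m) (2 ^ m)"
proof -
  have "gate_at m k G \<in> carrier_mat (2 ^ k * 4 * 2 ^ (m - k - 2)) (2 ^ k * 4 * 2 ^ (m - k - 2))"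
    unfolding gate_at_def by (intro kron_carrier assms one_carrier_mat)
  then show ?thesis by (simp only: gate_at_dim[OF assms(2)])
qed

lemma gate_at_unitary:
  assumes "is_matchgate G" "k + 1 < m"
  shows "mat_adjoint (gate_at m k G) * gate_at m k G = 1\<^sub>m (2 ^ m)"
proof -
  note G = matchgate_carrier[OF assms(1)] 
  have "mat_adjoint (gate_at m k G) * gate_at m k G = 1\<^sub>m (2 ^ k * 4 * 2 ^ (m - k - 2))"
    unfolding gate_at_def mat_adjoint_kron mat_adjoint_one
    by (subst kron_mult[OF kron_carrier[OF one_carrier_mat mat_adjoint_carrier[OF G]]
            kron_carrier[OF one_carrier_mat G] one_carrier_mat one_carrier_mat],
        subst kron_mult[OF one_carrier_mat one_carrier_mat mat_adjoint_carrier[OF G] G])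
      (simp add: matchgate_unitary[OF assms(1)])
  then show ?thesis by (simp only: gate_at_dim[OF assms(2)])
qed

lemma matchgate_circuit_carrier:
  "matchgate_circuit m U \<Longrightarrow> U \<in> carrier_mat (2 ^ m) (2 ^ m)"
  by (induction rule: matchgate_circuit.induct)
    (auto intro!: mult_carrier_mat gate_at_carrier matchgate_carrier)

text \<open>Composition in the Heisenberg picture: circuits grow on the left, and the gate added
  last is the first to act on the observable.\<close>

lemma mult_conj_assoc:
  fixes A :: "complex mat"
  assumes "A \<in> carrier_mat n n" "U \<in> carrier_mat n n" "M \<in> carrier_mat n n"
  shows "mat_adjoint (A * U) * (M * (A * U)) = mat_adjoint U * ((mat_adjoint A * (M * A)) * U)"
proof -
  note c = assms mat_adjoint_carrier[OF assms(1)] mat_adjoint_carrier[OF assms(2)]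
  have "mat_adjoint (A * U) * (M * (A * U)) = mat_adjoint U * (mat_adjoint A * (M * (A * U)))"
    unfolding mat_adjoint_mult[OF assms(1,2)] 
    by (rule assoc_mult_mat[OF c(5,4)]) (rule c mult_carrier_mat)+
  also have "mat_adjoint A * (M * (A * U)) = (mat_adjoint A * (M * A)) * U"
    by (simp only: assoc_mult_mat[OF c(3,1,2), symmetric]
        assoc_mult_mat[OF c(4) mult_carrier_mat[OF c(3,1)] c(2), symmetric])
  finally show ?thesis .
qed

text \<open>Conjugation is multiplicative because \<open>U * mat_adjoint U\<close> can be inserted
  between the factors; this allows the two Majorana factors of Z to evolve separately.\<close>

lemma mult_conj_mult:
  fixes U :: "complex mat"
  assumes "U \<in> carrier_mat n n" "M \<in> carrier_mat n n" "N \<in> carrier_mat n n"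
    and "U * mat_adjoint U = 1\<^sub>m n"
  shows "mat_adjoint U * ((M * N) * U) = (mat_adjoint U * (M * U)) * (mat_adjoint U * (N * U))"
proof -
  note c = assms(1-3) mat_adjoint_carrier[OF assms(1)]
  have "(mat_adjoint U * (M * U)) * (mat_adjoint U * (N * U)) = mat_adjoint U * ((M * U) * (mat_adjoint U * (N * U)))"
    by (rule assoc_mult_mat[OF c(4)]) (rule c mult_carrier_mat)+
  also have "(M * U) * (mat_adjoint U * (N * U)) = M * (U * (mat_adjoint U * (N * U)))"
    by (rule assoc_mult_mat[OF c(2,1)]) (rule c mult_carrier_mat)+
  also have "U * (mat_adjoint U * (N * U)) = (U * mat_adjoint U) * (N * U)"
    by (rule assoc_mult_mat[OF c(1,4), symmetric]) (rule c mult_carrier_mat)+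
  also have "\<dots> = N * U"
    unfolding assms(4) by (rule left_mult_one_mat) (rule c mult_carrier_mat)+
  also have "M * (N * U) = (M * N) * U"
    by (rule assoc_mult_mat[OF c(2,3,1), symmetric])
  finally show ?thesis by simp
qed

lemma matchgate_circuit_unitary:
  "matchgate_circuit m U \<Longrightarrow> mat_adjoint U * U = 1\<^sub>m (2 ^ m)"
proof (induction rule: matchgate_circuit.induct)
  case (gate U G k)
  note g = gate_at_carrier[OF matchgate_carrier[OF gate.hyps(2)] gate.hyps(3)]
  note U = matchgate_circuit_carrier[OF gate.hyps(1)]
  have "mat_adjoint (gate_at m k G * U) * (gate_at m k G * U) =
      mat_adjoint U * (mat_adjoint (gate_at m k G) * gate_at m k G * U)"
    using mult_conj_assoc[OF g U one_carrier_mat] g U by (simp add: left_mult_one_mat)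
  then show ?case
    using gate.IH U by (simp add: gate_at_unitary[OF gate.hyps(2,3)])
qed simp

lemma matchgate_circuit_lift:
  "matchgate_circuit m U \<Longrightarrow> matchgate_circuit (Suc m) (kron (1\<^sub>m 2) U)"
proof (induction rule: matchgate_circuit.induct)
  case empty
  show ?case using matchgate_circuit.empty[of "Suc m"] by simp
next
  case (gate U G k)
  note g = gate_at_carrier[OF matchgate_carrier[OF gate.hyps(2)] gate.hyps(3)]
  note U = matchgate_circuit_carrier[OF gate.hyps(1)]
  have "kron (1\<^sub>m 2) (gate_at m k G * U) = gate_at (Suc m) (Suc k) G * kron (1\<^sub>m 2) U"
    by (simp add: gate_at_Suc matchgate_carrier[OF gate.hyps(2)]
        kron_mult[OF one_carrier_mat one_carrier_mat g U])
  with matchgate_circuit.gate[OF gate.IH gate.hyps(2), of "Suc k"] gate.hyps(3)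
  show ?case by simp
qed

section \<open>Outcome probabilities of the first qubit\<close>

definition first_Z :: "nat \<Rightarrow> complex mat" where
  "first_Z m = kron pauli_Z (1\<^sub>m (2 ^ (m - 1)))"

lemma first_Z_carrier: "1 \<le> m \<Longrightarrow> first_Z m \<in> carrier_mat (2 ^ m) (2 ^ m)"
  using kron_carrier[OF pauli_carrier(1) one_carrier_mat[of "2 ^ (m - 1)"]]
  by (cases m) (simp_all add: first_Z_def)

lemma spin_simps [simp]: "spin True = -1" "spin False = 1"
  by (simp_all add: spin_def)

lemma pauli_Z_diag [simp]: "pauli_Z $$ (of_bool b, of_bool b) = of_real (spin b)"
  by (cases b) (simp_all add: pauli_Z_def)

lemma basis_index_inject:
  "length x = length y \<Longrightarrow> basis_index x = basis_index y \<longleftrightarrow> x = y"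
  using bij_betw_basis_index[of "length y"] by (auto simp: bij_betw_def inj_on_def)

lemma first_Z_index:
  assumes "length x = m" "length y = m" "1 \<le> m"
  shows "first_Z m $$ (basis_index x, basis_index y) = (if x = y then of_real (spin (hd x)) else 0)"
proof -
  obtain n b x' c y' where *: "m = Suc n" "x = b # x'" "y = c # y'" "length x' = n" "length y' = n"
    using assms by (cases m; cases x; cases y) auto
  have "first_Z m $$ (basis_index x, basis_index y) =
      pauli_Z $$ (of_bool b, of_bool c) * (1\<^sub>m (2 ^ n) $$ (basis_index x', basis_index y'))"
    unfolding first_Z_def * by (subst kron_index_Cons[of _ _ n]) (use * in simp_all)
  also have "\<dots> = (if x = y then of_real (spin (hd x)) else 0)"
    using * basis_index_inject[of x' y'] by (cases b; cases c) (simp_all add: pauli_Z_def)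
  finally show ?thesis .
qed

lemma sum_basis_index:
  fixes g :: "nat \<Rightarrow> 'a :: comm_monoid_add"
  shows "(\<Sum>i = 0..<2 ^ m. g i) = (\<Sum>y | length y = m. g (basis_index y))"
  using sum.reindex_bij_betw[OF bij_betw_basis_index, of g m] by (simp add: lessThan_atLeast0)

lemma finite_bool_lists [simp]: "finite {y :: bool list. length y = m}"
  using finite_lists_length_eq[of "UNIV :: bool set" m] by simp

text \<open>The projector onto outcome \<open>b\<close> is half the sum of the identity and
  \<open>spin b\<close> times Z, and the diagonal entry of the conjugated Z at \<open>x\<close> is
  the expectation of Z after applying \<open>U\<close> to \<open>ket x\<close>.\<close>

lemma prob_first_qubit_eq:
  assumes U: "U \<in> carrier_mat (2 ^ m) (2 ^ m)" "mat_adjoint U * U = 1\<^sub>m (2 ^ m)"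
    and m: "1 \<le> m" and x: "length x = m"
  shows "prob_first_qubit m (U *\<^sub>v ket x) b =
    (1 + spin b * Re ((mat_adjoint U * (first_Z m * U)) $$ (basis_index x, basis_index x))) / 2"
proof -
  let ?i = "basis_index x"
  let ?L = "{y :: bool list. length y = m}"
  define q where "q y = (cmod (U $$ (basis_index y, ?i)))\<^sup>2" for y
  have i: "?i < 2 ^ m" using x by simp
  \<comment> \<open>A basis state picks out a column of \<open>U\<close>; unitarity makes it a unit
    vector.\<close>
  have ket: "(U *\<^sub>v ket x) $ k = U $$ (k, ?i)" if "k < 2 ^ m" for k
  proof -
    have "(U *\<^sub>v ket x) $ k = (\<Sum>j = 0..<2 ^ m. U $$ (k, j) * (if j = ?i then 1 else 0))"
      using that U(1) x i by (simp add: ket_def scalar_prod_def)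
    also have "\<dots> = U $$ (k, ?i)" using i by (simp add: if_distrib[of "\<lambda>t. _ * t"] cong: if_cong)
    finally show ?thesis .
  qed
  have prob: "prob_first_qubit m (U *\<^sub>v ket x) b = (\<Sum>y | length y = m \<and> hd y = b. q y)"
    unfolding prob_first_qubit_def q_def by (rule sum.cong) (simp_all add: ket)
  have q: "cnj (U $$ (basis_index y, ?i)) * U $$ (basis_index y, ?i) = of_real (q y)" for y
    unfolding q_def by (metis complex_norm_square mult.commute of_real_power)
  have "(mat_adjoint U * U) $$ (?i, ?i) = (\<Sum>k = 0..<2 ^ m. cnj (U $$ (k, ?i)) * U $$ (k, ?i))"
    using U(1) i by (simp add: scalar_prod_def)
  also have "\<dots> = of_real (\<Sum>y\<in>?L. q y)"
    unfolding sum_basis_index q by simp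
  finally have one: "(\<Sum>y\<in>?L. q y) = 1"
    using U(2) i by (metis index_one_mat(1) of_real_eq_1_iff)
  have Z: "(first_Z m * U) $$ (basis_index y, ?i) = of_real (spin (hd y)) * U $$ (basis_index y, ?i)"
    if "length y = m" for y
  proof -
    have "(first_Z m * U) $$ (basis_index y, ?i) =
        (\<Sum>k = 0..<2 ^ m. first_Z m $$ (basis_index y, k) * U $$ (k, ?i))"
      using U(1) i that m first_Z_carrier[OF m] by (simp add: scalar_prod_def)
    also have "\<dots> = (\<Sum>z\<in>?L. (if y = z then of_real (spin (hd y)) else 0) * U $$ (basis_index z, ?i))"
      unfolding sum_basis_index by (rule sum.cong) (use that m in \<open>simp_all add: first_Z_index\<close>)
    also have "\<dots> = of_real (spin (hd y)) * U $$ (basis_index y, ?i)"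
      using that by (simp add: if_distrib[of "\<lambda>t. t * _"] cong: if_cong)
    finally show ?thesis .
  qed
  have "(mat_adjoint U * (first_Z m * U)) $$ (?i, ?i) =
      (\<Sum>k = 0..<2 ^ m. cnj (U $$ (k, ?i)) * (first_Z m * U) $$ (k, ?i))"
    using U(1) i first_Z_carrier[OF m] by (subst index_mult_mat) (simp_all add: scalar_prod_def)
  also have "\<dots> = (\<Sum>y\<in>?L. of_real (spin (hd y) * q y))"
    unfolding sum_basis_index
    by (rule sum.cong) (simp_all add: Z q[symmetric] mult_ac)
  finally have E: "Re ((mat_adjoint U * (first_Z m * U)) $$ (?i, ?i)) = (\<Sum>y\<in>?L. spin (hd y) * q y)"
    by simp
  have "(\<Sum>y | length y = m \<and> hd y = b. q y) = (\<Sum>y\<in>?L. if hd y = b then q y else 0)"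
    by (simp add: sum.If_cases Int_def)
  \<comment> \<open>The indicator of \<open>hd y = b\<close> equals
    \<open>(1 + spin b * spin (hd y)) / 2\<close>.\<close>
  also have "\<dots> = (\<Sum>y\<in>?L. (q y + spin b * (spin (hd y) * q y)) / 2)"
    by (rule sum.cong) (auto simp: spin_def)
  also have "\<dots> = (1 + spin b * (\<Sum>y\<in>?L. spin (hd y) * q y)) / 2"
    by (simp add: sum_divide_distrib[symmetric] sum.distrib sum_distrib_left one)
  finally show ?thesis by (simp add: prob E)
qed

section \<open>Circuits with prescribed weights\<close>

lemma spin_sum_Cons:
  "(\<Sum>k<Suc m. w k * spin ((b # x) ! k)) = w 0 * spin b + (\<Sum>k<m. w (Suc k) * spin (x ! k))"
  unfolding sum.lessThan_Suc_shift by simp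

lemma kron_lift_conj:
  assumes "V \<in> carrier_mat n n" "A \<in> carrier_mat 2 2" "B \<in> carrier_mat n n"
  shows "mat_adjoint (kron (1\<^sub>m 2) V) * (kron A B * kron (1\<^sub>m 2) V) = kron A (mat_adjoint V * (B * V))"
  by (simp add: mat_adjoint_kron kron_mult[OF assms(2) one_carrier_mat assms(3,1)]
      kron_mult[OF one_carrier_mat assms(2) mat_adjoint_carrier[OF assms(1)] mult_carrier_mat[OF assms(3,1)]]
      right_mult_one_mat[OF assms(2)] left_mult_one_mat[OF assms(2)] assms(2))

lemma conj_add:
  fixes U :: "complex mat"
  assumes "U \<in> carrier_mat n n" "M \<in> carrier_mat n n" "N \<in> carrier_mat n n"
  shows "mat_adjoint U * ((M + N) * U) = mat_adjoint U * (M * U) + mat_adjoint U * (N * U)"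
  by (simp only: add_mult_distrib_mat[OF assms(2,3,1)]
      mult_add_distrib_mat[OF mat_adjoint_carrier[OF assms(1)] mult_carrier_mat[OF assms(2,1)] mult_carrier_mat[OF assms(3,1)]])

lemma conj_smult:
  fixes U :: "complex mat"
  assumes "U \<in> carrier_mat n n" "M \<in> carrier_mat n n"
  shows "mat_adjoint U * ((c \<cdot>\<^sub>m M) * U) = c \<cdot>\<^sub>m (mat_adjoint U * (M * U))"
  by (simp only: mult_smult_assoc_mat[OF assms(2,1)]
      mult_smult_distrib[OF mat_adjoint_carrier[OF assms(1)] mult_carrier_mat[OF assms(2,1)]])

lemma conj_one:
  assumes "U \<in> carrier_mat n n" "mat_adjoint U * U = 1\<^sub>m n"
  shows "mat_adjoint U * (1\<^sub>m n * U) = 1\<^sub>m n"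
  using assms by (simp only: left_mult_one_mat)

text \<open>The double-angle formula: \<open>c\<close> and \<open>s\<close> are the cosine and sine
  of half the angle whose cosine is \<open>p\<close>.\<close>

lemma ex_cos_sin:
  fixes p :: real
  assumes "\<bar>p\<bar> \<le> 1"
  obtains c s where "c\<^sup>2 + s\<^sup>2 = 1" "c\<^sup>2 - s\<^sup>2 = p"
proof
  show "(sqrt ((1 + p) / 2))\<^sup>2 + (sqrt ((1 - p) / 2))\<^sup>2 = 1"
    "(sqrt ((1 + p) / 2))\<^sup>2 - (sqrt ((1 - p) / 2))\<^sup>2 = p"
    using assms by (simp_all add: field_simps)
qed

text \<open>On the even span both Z agree and on the odd span they are opposite, so the wanted
  diagonal part is \<alpha> + \<beta> times Z on the first qubit in one and \<alpha> - \<beta> times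
  it in the other. A rotation in each span prescribes these two double-angle cosines; both have
  absolute value at most 1 exactly under the assumption. The leftover terms flip both
  qubits.\<close>

lemma rotation_gate:
  fixes \<alpha> \<beta> :: real
  assumes "\<bar>\<alpha>\<bar> + \<bar>\<beta>\<bar> \<le> 1"
  obtains G \<sigma> \<tau> where "is_matchgate G"
    "mat_adjoint G * (kron pauli_Z (1\<^sub>m 2) * G) = 
      kron pauli_Z (of_real \<alpha> \<cdot>\<^sub>m 1\<^sub>m 2) + kron (1\<^sub>m 2) (of_real \<beta> \<cdot>\<^sub>m pauli_Z) +
      (kron (mat2 0 1 0 0) (mat2 0 \<sigma> \<tau> 0) + kron (mat2 0 0 1 0) (mat2 0 \<tau> \<sigma> 0))"
proof -
  obtain c s where cs: "c\<^sup>2 + s\<^sup>2 = 1" "c\<^sup>2 - s\<^sup>2 = \<alpha> + \<beta>"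
    by (rule ex_cos_sin[of "\<alpha> + \<beta>"]) (use assms in linarith)
  obtain c' s' where cs': "c'\<^sup>2 + s'\<^sup>2 = 1" "c'\<^sup>2 - s'\<^sup>2 = \<alpha> - \<beta>"
    by (rule ex_cos_sin[of "\<alpha> - \<beta>"]) (use assms in linarith)
  have "complex_of_real c * of_real c + of_real s * of_real s = 1"
    "complex_of_real c' * of_real c' + of_real s' * of_real s' = 1"
    using arg_cong[OF cs(1), of complex_of_real] arg_cong[OF cs'(1), of complex_of_real]
    by (simp_all add: power2_eq_square)
  note unit = this
  define G where "G = mgate (of_real c) (- of_real s) (of_real c') (- of_real s')"
  have 1: "is_matchgate G"
    unfolding is_matchgate_iff G_def
    by (intro exI conjI refl) (simp_all add: unit)
  have 2: "mat_adjoint G * (kron pauli_Z (1\<^sub>m 2) * G) = 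
     mat_of_rows_list 4 [[of_real (c\<^sup>2 - s\<^sup>2), 0, 0, - of_real (2 * c * s)],
       [0, of_real (c'\<^sup>2 - s'\<^sup>2), - of_real (2 * c' * s'), 0],
       [0, - of_real (2 * c' * s'), - of_real (c'\<^sup>2 - s'\<^sup>2), 0],
       [- of_real (2 * c * s), 0, 0, - of_real (c\<^sup>2 - s\<^sup>2)]]"
    unfolding G_def mgate_adjoint 
    by (simp add: mgate_def pauli_Z_def mat2_one kron_mat2 mat4_mult power2_eq_square algebra_simps)
  show ?thesis
    by (rule that[OF 1, of "- of_real (2 * c * s)" "- of_real (2 * c' * s')"])
      (unfold 2 cs(2) cs'(2), simp add: pauli_Z_def mat2_one mat2_smult kron_mat2 mat4_add)
qed

text \<open>A gate on the first two qubits turns \<open>Z\<close> on the first qubit into \<open>\<alpha> Z\<^sub>1 + \<beta> Z\<^sub>2\<close> plus terms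
  that flip the first qubit; the latter stay off-diagonal under everything that acts only on
  the other qubits.\<close>

lemma circuit_extend_weights:
  fixes \<alpha> \<beta> :: real
  assumes V: "matchgate_circuit m V" and m: "1 \<le> m" and \<alpha>\<beta>: "\<bar>\<alpha>\<bar> + \<bar>\<beta>\<bar> \<le> 1"
    and e: "\<And>x. length x = m \<Longrightarrow>
      (mat_adjoint V * (first_Z m * V)) $$ (basis_index x, basis_index x) = of_real (e x)"
  shows "\<exists>U. matchgate_circuit (Suc m) U \<and> (\<forall>b x. length x = m \<longrightarrow>
      (mat_adjoint U * (first_Z (Suc m) * U)) $$ (basis_index (b # x), basis_index (b # x)) =
        of_real (\<alpha> * spin b + \<beta> * e x))"
proof -
  obtain n where n: "m = Suc n" using m by (cases m) auto
  let ?N = "2 ^ n :: nat"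
  obtain G \<sigma> \<tau> where G: "is_matchgate G"
    "mat_adjoint G * (kron pauli_Z (1\<^sub>m 2) * G) = 
      kron pauli_Z (of_real \<alpha> \<cdot>\<^sub>m 1\<^sub>m 2) + kron (1\<^sub>m 2) (of_real \<beta> \<cdot>\<^sub>m pauli_Z) +
      (kron (mat2 0 1 0 0) (mat2 0 \<sigma> \<tau> 0) + kron (mat2 0 0 1 0) (mat2 0 \<tau> \<sigma> 0))"
    by (rule rotation_gate[OF \<alpha>\<beta>])
  note Gc = matchgate_carrier[OF G(1)]
  define L where "L = kron (1\<^sub>m 2) V"
  \<comment> \<open>The gate comes after the lifted \<open>V\<close>, so it acts on Z first and
    \<open>V\<close> then acts on the resulting terms.\<close>
  define U where "U = gate_at (Suc m) 0 G * L"
  have L: "matchgate_circuit (Suc m) L" unfolding L_def by (rule matchgate_circuit_lift[OF V])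
  have U: "matchgate_circuit (Suc m) U"
    unfolding U_def by (rule matchgate_circuit.gate[OF L G(1)]) (use m in simp)
  have Vc: "V \<in> carrier_mat (2 * ?N) (2 * ?N)"
    using matchgate_circuit_carrier[OF V] n by simp
  have Lc: "L \<in> carrier_mat (2 * (2 * ?N)) (2 * (2 * ?N))"
    unfolding L_def by (rule kron_carrier[OF one_carrier_mat Vc])
  have VV: "mat_adjoint V * V = 1\<^sub>m (2 * ?N)"
    using matchgate_circuit_unitary[OF V] n by simp
  have gate: "gate_at (Suc m) 0 G = kron G (1\<^sub>m ?N)"
    by (simp add: gate_at_0 n)
  have gc: "kron G (1\<^sub>m ?N) \<in> carrier_mat (2 * (2 * ?N)) (2 * (2 * ?N))"
    using kron_carrier[OF Gc one_carrier_mat[of ?N]] by simp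
  have Z: "first_Z (Suc m) = kron (kron pauli_Z (1\<^sub>m 2)) (1\<^sub>m ?N)"
    by (simp add: first_Z_def kron_assoc n)
  have Zc: "kron pauli_Z (1\<^sub>m 2) \<in> carrier_mat 4 4"
    using kron_carrier[OF pauli_carrier(1) one_carrier_mat[of 2]] by simp
  have ZNc: "first_Z (Suc m) \<in> carrier_mat (2 * (2 * ?N)) (2 * (2 * ?N))"
    using first_Z_carrier[of "Suc m"] n by simp
  \<comment> \<open>The factors on the last \<open>m\<close> qubits of the four terms; conjugation
    by the lifted \<open>V\<close> changes only these.\<close>
  let ?A = "of_real \<alpha> \<cdot>\<^sub>m 1\<^sub>m (2 * ?N)" and ?B = "of_real \<beta> \<cdot>\<^sub>m first_Z m"
  let ?C = "kron (mat2 0 \<sigma> \<tau> 0) (1\<^sub>m ?N)" and ?D = "kron (mat2 0 \<tau> \<sigma> 0) (1\<^sub>m ?N)"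
  have c: "?A \<in> carrier_mat (2 * ?N) (2 * ?N)" "?B \<in> carrier_mat (2 * ?N) (2 * ?N)"
    "?C \<in> carrier_mat (2 * ?N) (2 * ?N)" "?D \<in> carrier_mat (2 * ?N) (2 * ?N)"
    using first_Z_carrier[OF m] n kron_carrier[OF mat2_carrier one_carrier_mat[of ?N]] by simp_all
  have 2: "mat2 0 1 0 0 \<in> carrier_mat 2 2" "mat2 0 0 1 0 \<in> carrier_mat 2 2"
    by (rule mat2_carrier)+
  have "mat_adjoint (gate_at (Suc m) 0 G) * (first_Z (Suc m) * gate_at (Suc m) 0 G) =
    kron (mat_adjoint G * (kron pauli_Z (1\<^sub>m 2) * G)) (1\<^sub>m ?N)"
    unfolding gate Z mat_adjoint_kron mat_adjoint_one
    by (simp add: kron_mult[OF Zc Gc one_carrier_mat one_carrier_mat]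
        kron_mult[OF mat_adjoint_carrier[OF Gc] mult_carrier_mat[OF Zc Gc] one_carrier_mat one_carrier_mat])
  also have "\<dots> = kron pauli_Z ?A + kron (1\<^sub>m 2) ?B + (kron (mat2 0 1 0 0) ?C + kron (mat2 0 0 1 0) ?D)"
  proof -
    have k: "kron X Y \<in> carrier_mat 4 4" if "X \<in> carrier_mat 2 2" "Y \<in> carrier_mat 2 2" for X Y
      using kron_carrier[OF that] by simp
    show ?thesis
      unfolding G(2)
      by (subst kron_add_left[of _ 4 4], (rule add_carrier_mat k pauli_carrier one_carrier_mat mat2_carrier smult_carrier_mat)+)+
        (simp add: kron_assoc kron_smult_left kron_smult_right first_Z_def n)
  qed
  finally have "mat_adjoint U * (first_Z (Suc m) * U) = mat_adjoint L * 
      ((kron pauli_Z ?A + kron (1\<^sub>m 2) ?B + (kron (mat2 0 1 0 0) ?C + kron (mat2 0 0 1 0) ?D)) * L)"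
    unfolding U_def by (subst mult_conj_assoc[OF gc[folded gate] Lc ZNc]) simp
  also have "\<dots> = kron pauli_Z (mat_adjoint V * (?A * V)) + kron (1\<^sub>m 2) (mat_adjoint V * (?B * V)) +
     (kron (mat2 0 1 0 0) (mat_adjoint V * (?C * V)) + kron (mat2 0 0 1 0) (mat_adjoint V * (?D * V)))"
    unfolding L_def
    by (simp only: conj_add[OF Lc[unfolded L_def]] add_carrier_mat kron_carrier pauli_carrier one_carrier_mat 2 c
        kron_lift_conj[OF Vc])
  finally have main: "mat_adjoint U * (first_Z (Suc m) * U) =
     kron pauli_Z (mat_adjoint V * (?A * V)) + kron (1\<^sub>m 2) (mat_adjoint V * (?B * V)) +
     (kron (mat2 0 1 0 0) (mat_adjoint V * (?C * V)) + kron (mat2 0 0 1 0) (mat_adjoint V * (?D * V)))" .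
  have "(mat_adjoint U * (first_Z (Suc m) * U)) $$ (basis_index (b # x), basis_index (b # x)) =
        of_real (\<alpha> * spin b + \<beta> * e x)" if x: "length x = m" for b x
  proof -
    let ?i = "basis_index (b # x)"
    have i: "?i < 2 * (2 * ?N)" "basis_index x < 2 * ?N"
      using basis_index_less'[of "b # x" "Suc m"] basis_index_less'[of x m] x n by simp_all
    have kc: "mat_adjoint V * (Y * V) \<in> carrier_mat (2 * ?N) (2 * ?N)" if "Y \<in> carrier_mat (2 * ?N) (2 * ?N)" for Y
      by (rule that Vc mat_adjoint_carrier mult_carrier_mat)+
    have ki: "kron X (mat_adjoint V * (Y * V)) $$ (?i, ?i) =
        X $$ (of_bool b, of_bool b) * (mat_adjoint V * (Y * V)) $$ (basis_index x, basis_index x)"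
      if "X \<in> carrier_mat 2 2" "Y \<in> carrier_mat (2 * ?N) (2 * ?N)" for X Y
      by (rule kron_index_Cons[of _ _ m]) (use that kc[OF that(2)] x n in simp_all)
    have kd: "dim_row (mat_adjoint V * (Y * V)) = 2 * ?N" "dim_col (mat_adjoint V * (Y * V)) = 2 * ?N" for Y
      using Vc by auto
    have zero: "mat2 0 1 0 0 $$ (of_bool b, of_bool b) = 0" "mat2 0 0 1 0 $$ (of_bool b, of_bool b) = 0"
      "1\<^sub>m 2 $$ (of_bool b, of_bool b) = (1 :: complex)"
      by (cases b; simp)+
    have A: "mat_adjoint V * (?A * V) = of_real \<alpha> \<cdot>\<^sub>m 1\<^sub>m (2 * ?N)"
      by (simp only: conj_smult[OF Vc one_carrier_mat] conj_one[OF Vc VV])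
    have B: "mat_adjoint V * (?B * V) = of_real \<beta> \<cdot>\<^sub>m (mat_adjoint V * (first_Z m * V))"
      by (rule conj_smult[OF Vc]) (use first_Z_carrier[OF m] n in simp)
    have "(mat_adjoint U * (first_Z (Suc m) * U)) $$ (?i, ?i) =
      of_real (spin b) * (mat_adjoint V * (?A * V)) $$ (basis_index x, basis_index x) +
      (mat_adjoint V * (?B * V)) $$ (basis_index x, basis_index x)"
      unfolding main using i
      by (simp add: kd ki[OF pauli_carrier(1) c(1)] ki[OF one_carrier_mat c(2)] ki[OF 2(1) c(3)] ki[OF 2(2) c(4)] zero
          del: kron_index index_mult_mat)
    also have "\<dots> = of_real (\<alpha> * spin b + \<beta> * e x)"
      unfolding A B using i e[OF x] kd[of "first_Z m"] by (simp add: mult.commute)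
    finally show ?thesis .
  qed
  with U show ?thesis by blast
qed

text \<open>The first weight is split off and the remaining ones are rescaled, so that each step
  needs only one gate on the first two qubits. The induction starts at two qubits: on one qubit the
  empty circuit is the only one, and it has weight 1.\<close>

lemma ex_circuit_with_weights:
  fixes w :: "nat \<Rightarrow> real"
  assumes "2 \<le> m" "(\<Sum>k<m. \<bar>w k\<bar>) \<le> 1"
  shows "\<exists>U. matchgate_circuit m U \<and> (\<forall>x. length x = m \<longrightarrow>
    (mat_adjoint U * (first_Z m * U)) $$ (basis_index x, basis_index x) =
      of_real (\<Sum>k<m. w k * spin (x ! k)))"
  using assms
proof (induction m arbitrary: w rule: dec_induct)
  case base
  have 1: "(mat_adjoint (1\<^sub>m (2 ^ 1)) * (first_Z 1 * 1\<^sub>m (2 ^ 1))) $$ (basis_index x, basis_index x) =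
      of_real (spin (hd x))" if "length x = 1" for x
    using first_Z_carrier[of 1] first_Z_index[of x 1 x] that by simp
  have "\<bar>w 0\<bar> + \<bar>w 1\<bar> \<le> 1" using base by (simp add: numeral_2_eq_2)
  from circuit_extend_weights[OF matchgate_circuit.empty[of 1] _ this 1]
  obtain U where U: "matchgate_circuit 2 U" "\<And>b x. length x = 1 \<Longrightarrow>
      (mat_adjoint U * (first_Z 2 * U)) $$ (basis_index (b # x), basis_index (b # x)) =
        of_real (w 0 * spin b + w 1 * spin (hd x))"
    by (auto simp: numeral_2_eq_2)
  show ?case
  proof (intro exI[of _ U] conjI allI impI U(1))
    fix x :: "bool list" assume "length x = 2"
    then obtain b c where x: "x = [b, c]" by (auto simp: length_Suc_conv numeral_2_eq_2)
    show "(mat_adjoint U * (first_Z 2 * U)) $$ (basis_index x, basis_index x) =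
        of_real (\<Sum>k<2. w k * spin (x ! k))"
      using U(2)[of "[c]" b] by (simp add: x numeral_2_eq_2)
  qed
next
  case (step m)
  \<comment> \<open>The mass available to the remaining qubits. It may exceed what they use, since
    the claim only asks for total mass at most 1.\<close>
  define \<beta> where "\<beta> = 1 - \<bar>w 0\<bar>"
  have w: "\<bar>w 0\<bar> + (\<Sum>k<m. \<bar>w (Suc k)\<bar>) \<le> 1"
    using step.prems unfolding sum.lessThan_Suc_shift by simp
  then have \<beta>: "(\<Sum>k<m. \<bar>w (Suc k)\<bar>) \<le> \<beta>" by (simp add: \<beta>_def)
  then have \<beta>0: "0 \<le> \<beta>" by (meson sum_nonneg abs_ge_zero order_trans)
  have "(\<Sum>k<m. \<bar>w (Suc k) / \<beta>\<bar>) \<le> 1"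
  proof (cases "\<beta> = 0")
    case False
    with \<beta> \<beta>0 show ?thesis by (simp add: abs_divide flip: sum_divide_distrib)
  qed simp
  from step.IH[OF this] obtain V where V: "matchgate_circuit m V" "\<And>x. length x = m \<Longrightarrow>
    (mat_adjoint V * (first_Z m * V)) $$ (basis_index x, basis_index x) =
      of_real (\<Sum>k<m. w (Suc k) / \<beta> * spin (x ! k))"
    by blast
  have "\<bar>w 0\<bar> + \<bar>\<beta>\<bar> \<le> 1" using \<beta>0 by (simp add: \<beta>_def)
  from circuit_extend_weights[OF V(1) _ this V(2)] step.hyps
  obtain U where U: "matchgate_circuit (Suc m) U" "\<And>b x. length x = m \<Longrightarrow>
      (mat_adjoint U * (first_Z (Suc m) * U)) $$ (basis_index (b # x), basis_index (b # x)) =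
        of_real (w 0 * spin b + \<beta> * (\<Sum>k<m. w (Suc k) / \<beta> * spin (x ! k)))"
    by auto
  \<comment> \<open>If \<beta> is 0, division yields 0 by default, but all remaining weights vanish
    as well.\<close>
  have \<beta>w: "\<beta> * (w (Suc k) / \<beta>) = w (Suc k)" if "k < m" for k
  proof (cases "\<beta> = 0")
    case True
    with \<beta> have "(\<Sum>k<m. \<bar>w (Suc k)\<bar>) = 0" by (simp add: antisym sum_nonneg)
    with that have "w (Suc k) = 0" by (simp add: sum_nonneg_eq_0_iff)
    then show ?thesis by simp
  qed simp
  show ?case
  proof (intro exI[of _ U] conjI allI impI U(1))
    fix x :: "bool list" assume "length x = Suc m"
    then obtain b y where x: "x = b # y" "length y = m" by (auto simp: length_Suc_conv)
    have "\<beta> * (\<Sum>k<m. w (Suc k) / \<beta> * spin (y ! k)) = (\<Sum>k<m. \<beta> * (w (Suc k) / \<beta>) * spin (y ! k))"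
      by (simp only: sum_distrib_left mult.assoc)
    also have "\<dots> = (\<Sum>k<m. w (Suc k) * spin (y ! k))"
      by (rule sum.cong) (simp_all add: \<beta>w del: times_divide_eq_right)
    finally show "(mat_adjoint U * (first_Z (Suc m) * U)) $$ (basis_index x, basis_index x) =
        of_real (\<Sum>k<Suc m. w k * spin (x ! k))"
      using U(2)[OF x(2), of b] unfolding x(1) spin_sum_Cons by simp
  qed
qed

section \<open>Conjugation of Majorana operators\<close>

text \<open>The Jordan-Wigner form of a real combination of Majorana operators. One complex number
  per qubit carries the coefficients of its X and Y operators, and the factor \<open>pauli_Z\<close>
  in the recursion builds the Z strings of the later qubits. Without qubits the space has dimension
  one, hence the base case.\<close>

fun majorana :: "complex list \<Rightarrow> complex mat" where
  "majorana [] = 0\<^sub>m 1 1"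
| "majorana (z # zs) = kron (equatorial z) (1\<^sub>m (2 ^ length zs)) + kron pauli_Z (majorana zs)"

lemma majorana_carrier: "majorana zs \<in> carrier_mat (2 ^ length zs) (2 ^ length zs)"
proof (induction zs)
  case (Cons z zs)
  show ?case
    using kron_carrier[OF pauli_carrier(2) one_carrier_mat] kron_carrier[OF pauli_carrier(1) Cons]
    by (simp add: add_carrier_mat)
qed simp

lemma majorana_carrier': "length zs = m \<Longrightarrow> majorana zs \<in> carrier_mat (2 ^ m) (2 ^ m)"
  using majorana_carrier by blast

lemma pauli_mult:
  "pauli_Z * pauli_Z = 1\<^sub>m 2"
  "equatorial z * equatorial w = mat2 (z * cnj w) 0 0 (cnj z * w)"
  "equatorial z * pauli_Z = mat2 0 (- z) (cnj z) 0"
  "pauli_Z * equatorial z = mat2 0 z (- cnj z) 0"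
  by (simp_all add: pauli_Z_def equatorial_def mat2_mult mat2_one)

lemma add_mat_swap:
  fixes A B C D :: "complex mat"
  assumes "A \<in> carrier_mat m n" "B \<in> carrier_mat m n" "C \<in> carrier_mat m n" "D \<in> carrier_mat m n"
  shows "(A + B) + (C + D) = (A + D) + (C + B)"
  using assms by (intro eq_matI) auto

text \<open>The product is sorted into terms diagonal in the first qubit and terms flipping it. The
  flipping terms cancel in a square and contribute nothing to diagonal entries, which are its two
  uses.\<close>

lemma majorana_mult:
  assumes "length zs = m" "length ws = m"
  shows "majorana (z # zs) * majorana (w # ws) =
    (kron (mat2 (z * cnj w) 0 0 (cnj z * w)) (1\<^sub>m (2 ^ m)) + kron (1\<^sub>m 2) (majorana zs * majorana ws)) +
    (kron (mat2 0 (- z) (cnj z) 0) (majorana ws) + kron (mat2 0 w (- cnj w) 0) (majorana zs))"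
proof -
  let ?n = "2 ^ m :: nat"
  note c = pauli_carrier one_carrier_mat[of ?n] majorana_carrier'[OF assms(1)] majorana_carrier'[OF assms(2)]
  note k = kron_carrier[OF c(2)[of z] c(3)] kron_carrier[OF c(1) c(4)]
    kron_carrier[OF c(2)[of w] c(3)] kron_carrier[OF c(1) c(5)]
  have "majorana (z # zs) * majorana (w # ws) =
      (kron (equatorial z) (1\<^sub>m ?n) * kron (equatorial w) (1\<^sub>m ?n) + kron pauli_Z (majorana zs) * kron (equatorial w) (1\<^sub>m ?n)) +
      (kron (equatorial z) (1\<^sub>m ?n) * kron pauli_Z (majorana ws) + kron pauli_Z (majorana zs) * kron pauli_Z (majorana ws))"
    unfolding majorana.simps assms
    by (simp only: mult_add_distrib_mat[OF add_carrier_mat[OF k(2)] k(3,4)]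
       add_mult_distrib_mat[OF k(1,2,3)] add_mult_distrib_mat[OF k(1,2,4)])
  also have "\<dots> = (kron (mat2 (z * cnj w) 0 0 (cnj z * w)) (1\<^sub>m ?n) + kron (mat2 0 w (- cnj w) 0) (majorana zs)) +
      (kron (mat2 0 (- z) (cnj z) 0) (majorana ws) + kron (1\<^sub>m 2) (majorana zs * majorana ws))"
    by (simp add: kron_mult[OF c(2,2,3,3)] kron_mult[OF c(1,2,4,3)] kron_mult[OF c(2,1,3,5)] kron_mult[OF c(1,1,4,5)]
       pauli_mult left_mult_one_mat[OF c(5)] right_mult_one_mat[OF c(4)])
  also have "\<dots> = (kron (mat2 (z * cnj w) 0 0 (cnj z * w)) (1\<^sub>m ?n) + kron (1\<^sub>m 2) (majorana zs * majorana ws)) +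
      (kron (mat2 0 (- z) (cnj z) 0) (majorana ws) + kron (mat2 0 w (- cnj w) 0) (majorana zs))"
    using kron_carrier[OF mat2_carrier c(3)] kron_carrier[OF mat2_carrier c(4)]
      kron_carrier[OF mat2_carrier c(5)] kron_carrier[OF one_carrier_mat[of 2] mult_carrier_mat[OF c(4,5)]]
    by (intro add_mat_swap)
  finally show ?thesis .
qed

text \<open>The Clifford relations in one formula. They make the norm of the coefficients an
  algebraic quantity that unitary conjugation preserves.\<close>

lemma majorana_square:
  "majorana zs * majorana zs = of_real (\<Sum>z\<leftarrow>zs. (cmod z)\<^sup>2) \<cdot>\<^sub>m 1\<^sub>m (2 ^ length zs)"
proof (induction zs)
  case Nil
  show ?case by (intro eq_matI) auto
next
  case (Cons z zs)
  let ?n = "2 ^ length zs :: nat" and ?s = "\<Sum>z\<leftarrow>zs. (cmod z)\<^sup>2"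
  note c = majorana_carrier[of zs]
  have z: "z * cnj z = of_real ((cmod z)\<^sup>2)" "cnj z * z = of_real ((cmod z)\<^sup>2)"
    by (simp_all add: complex_norm_square[symmetric] mult.commute)
  have d: "mat2 (z * cnj z) 0 0 (cnj z * z) = of_real ((cmod z)\<^sup>2) \<cdot>\<^sub>m 1\<^sub>m 2"
    unfolding z by (simp add: mat2_one mat2_smult)
  have "kron (mat2 0 (- z) (cnj z) 0) (majorana zs) + kron (mat2 0 z (- cnj z) 0) (majorana zs) =
      kron (mat2 0 0 0 0) (majorana zs)"
    by (subst kron_add_left[OF mat2_carrier mat2_carrier, symmetric]) (simp add: mat2_add)
  also have "mat2 0 0 0 0 = 0\<^sub>m 2 2"
    by (rule eq_mat2I) auto
  finally have 0: "kron (mat2 0 (- z) (cnj z) 0) (majorana zs) + kron (mat2 0 z (- cnj z) 0) (majorana zs) =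
      0\<^sub>m (2 * ?n) (2 * ?n)"
    using c by simp
  show ?case
    unfolding majorana_mult[OF refl refl] 0 d Cons.IH kron_smult_left kron_smult_right
    by (intro eq_matI) (auto simp del: kron_index)
qed

text \<open>The diagonal contribution of a qubit is \<open>z * cnj w\<close> for bit 0 and its
  conjugate for bit 1, so the bit enters the imaginary part only as a sign.\<close>

lemma majorana_diag:
  assumes "length zs = m" "length ws = m" "length x = m"
  shows "Im ((majorana zs * majorana ws) $$ (basis_index x, basis_index x)) =
    (\<Sum>k<m. Im (zs ! k * cnj (ws ! k)) * spin (x ! k))"
  using assms
proof (induction m arbitrary: zs ws x)
  case (Suc m)
  obtain z zs' w ws' b y where *: "zs = z # zs'" "ws = w # ws'" "x = b # y"
    "length zs' = m" "length ws' = m" "length y = m"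
    using Suc.prems by (auto simp: length_Suc_conv)
  let ?i = "basis_index (b # y)" and ?n = "2 ^ m :: nat"
  note c = majorana_carrier'[OF *(4)] majorana_carrier'[OF *(5)]
  note cc = mult_carrier_mat[OF c]
  have i: "?i < 2 * ?n" using basis_index_less'[of "b # y" "Suc m"] * by simp
  have k: "kron (mat2 p q r s) B $$ (?i, ?i) = (if b then s else p) * B $$ (basis_index y, basis_index y)"
    if "B \<in> carrier_mat ?n ?n" for p q r s B
    using kron_index_Cons[OF mat2_carrier that *(6,6), of p q r s b b] by (cases b) simp_all
  have "(majorana zs * majorana ws) $$ (?i, ?i) =
      (if b then cnj z * w else z * cnj w) + (majorana zs' * majorana ws') $$ (basis_index y, basis_index y)"
    unfolding * majorana_mult[OF *(4,5)] unfolding mat2_one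
    using i c *(6) by (simp add: k[OF one_carrier_mat] k[OF c(1)] k[OF c(2)] k[OF cc] del: kron_index index_mult_mat(1))
  moreover have "Im (if b then cnj z * w else z * cnj w) = Im (z * cnj w) * spin b"
    by simp
  ultimately show ?case
    using Suc.IH[OF *(4-6)] unfolding sum.lessThan_Suc_shift by (simp add: *(1-3))
qed simp

text \<open>Induction moves the gate to the first two qubits. There it mixes the four Majorana
  operators of these qubits, while all later ones carry the parity ZZ on them, which a matchgate
  fixes.\<close>

lemma gate_conj_majorana:
  assumes "is_matchgate G" "k + 1 < m" "length zs = m"
  shows "\<exists>zs'. length zs' = m \<and> mat_adjoint (gate_at m k G) * (majorana zs * gate_at m k G) = majorana zs'"
  using assms(2,3)
proof (induction m arbitrary: k zs)
  case (Suc m)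
  note Gc = matchgate_carrier[OF assms(1)]
  show ?case
  proof (cases k)
    case 0
    obtain n where n: "m = Suc n" using Suc.prems by (cases m) auto
    obtain z w zs0 where zs: "zs = z # w # zs0" "length zs0 = n"
      using Suc.prems n by (auto simp: length_Suc_conv)
    let ?N = "2 ^ n :: nat"
    note Mc = majorana_carrier'[OF zs(2)]
    obtain z' w' where z'w': "mat_adjoint G * ((kron (equatorial z) (1\<^sub>m 2) + kron pauli_Z (equatorial w)) * G) =
        kron (equatorial z') (1\<^sub>m 2) + kron pauli_Z (equatorial w')"
      using matchgate_conj_majorana2[OF assms(1)] by blast
    have k4: "kron A B \<in> carrier_mat 4 4" if "A \<in> carrier_mat 2 2" "B \<in> carrier_mat 2 2" for A B
      using kron_carrier[OF that] by simp
    have Cc: "kron (equatorial u) (1\<^sub>m 2) + kron pauli_Z (equatorial v) \<in> carrier_mat 4 4" for u v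
      by (intro add_carrier_mat k4 pauli_carrier)
    have ZZ: "kron pauli_Z pauli_Z \<in> carrier_mat 4 4"
      by (intro k4 pauli_carrier)
    \<comment> \<open>Regrouping by the first two qubits separates their own operators from those
      that carry ZZ there.\<close>
    have split: "majorana (u # v # zs0) = kron (kron (equatorial u) (1\<^sub>m 2) + kron pauli_Z (equatorial v)) (1\<^sub>m ?N) +
        kron (kron pauli_Z pauli_Z) (majorana zs0)" for u v
    proof -
      have c: "kron (equatorial v) (1\<^sub>m ?N) \<in> carrier_mat (2 * ?N) (2 * ?N)"
        "kron pauli_Z (majorana zs0) \<in> carrier_mat (2 * ?N) (2 * ?N)"
        by (rule kron_carrier pauli_carrier one_carrier_mat Mc)+
      have d: "kron (kron (equatorial u) (1\<^sub>m 2)) (1\<^sub>m ?N) \<in> carrier_mat (4 * ?N) (4 * ?N)"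
        "kron (kron pauli_Z (equatorial v)) (1\<^sub>m ?N) \<in> carrier_mat (4 * ?N) (4 * ?N)"
        "kron (kron pauli_Z pauli_Z) (majorana zs0) \<in> carrier_mat (4 * ?N) (4 * ?N)"
        by (rule kron_carrier k4 pauli_carrier one_carrier_mat Mc)+
      have "majorana (u # v # zs0) = kron (equatorial u) (kron (1\<^sub>m 2) (1\<^sub>m ?N)) +
         (kron pauli_Z (kron (equatorial v) (1\<^sub>m ?N)) + kron pauli_Z (kron pauli_Z (majorana zs0)))"
        by (simp add: kron_add_right[OF c] zs(2))
      then show ?thesis
        unfolding kron_assoc[symmetric]
        by (simp add: kron_add_left[OF k4[OF pauli_carrier(2) one_carrier_mat] k4[OF pauli_carrier(1,2)]]
            assoc_add_mat[OF d] del: kron_one)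
    qed
    have g: "gate_at (Suc m) k G = kron G (1\<^sub>m ?N)" by (simp add: 0 gate_at_0 n)
    have gc: "kron G (1\<^sub>m ?N) \<in> carrier_mat (4 * ?N) (4 * ?N)" by (rule kron_carrier[OF Gc one_carrier_mat])
    have ad: "mat_adjoint G \<in> carrier_mat 4 4" by (rule mat_adjoint_carrier[OF Gc])
    have "mat_adjoint (gate_at (Suc m) k G) * (majorana zs * gate_at (Suc m) k G) = 
        kron (mat_adjoint G * ((kron (equatorial z) (1\<^sub>m 2) + kron pauli_Z (equatorial w)) * G)) (1\<^sub>m ?N) +
        kron (mat_adjoint G * (kron pauli_Z pauli_Z * G)) (majorana zs0)"
      unfolding g zs(1) split conj_add[OF gc kron_carrier[OF Cc one_carrier_mat] kron_carrier[OF ZZ Mc]]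
      by (simp add: mat_adjoint_kron kron_mult[OF Cc Gc one_carrier_mat one_carrier_mat]
          kron_mult[OF ZZ Gc Mc one_carrier_mat]
          kron_mult[OF ad mult_carrier_mat[OF Cc Gc] one_carrier_mat one_carrier_mat]
          kron_mult[OF ad mult_carrier_mat[OF ZZ Gc] one_carrier_mat Mc]
          right_mult_one_mat[OF Mc] left_mult_one_mat[OF Mc])
    also have "\<dots> = majorana (z' # w' # zs0)"
      unfolding z'w' matchgate_conj_ZZ[OF assms(1)] split ..
    finally show ?thesis using zs(2) n by (intro exI[of _ "z' # w' # zs0"]) simp
  next
    case k: (Suc k')
    obtain z zs0 where zs: "zs = z # zs0" "length zs0 = m"
      using Suc.prems by (auto simp: length_Suc_conv)
    have k': "k' + 1 < m" using Suc.prems k by simp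
    from Suc.IH[OF k' zs(2)] obtain zs1 where zs1: "length zs1 = m"
      "mat_adjoint (gate_at m k' G) * (majorana zs0 * gate_at m k' G) = majorana zs1" by blast
    let ?g = "gate_at m k' G" and ?N = "2 ^ m :: nat"
    have gc: "?g \<in> carrier_mat ?N ?N" by (rule gate_at_carrier[OF Gc k'])
    note Mc = majorana_carrier'[OF zs(2)]
    have kg: "kron (1\<^sub>m 2) ?g \<in> carrier_mat (2 * ?N) (2 * ?N)" by (rule kron_carrier[OF one_carrier_mat gc])
    have c: "kron (equatorial z) (1\<^sub>m ?N) \<in> carrier_mat (2 * ?N) (2 * ?N)"
      "kron pauli_Z (majorana zs0) \<in> carrier_mat (2 * ?N) (2 * ?N)"
      by (rule kron_carrier pauli_carrier one_carrier_mat Mc)+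
    \<comment> \<open>The operators of the first qubit are the identity on the others and survive by
      unitarity; the leading Z of the others is untouched.\<close>
    have "mat_adjoint (gate_at (Suc m) k G) * (majorana zs * gate_at (Suc m) k G) =
       kron (equatorial z) (mat_adjoint ?g * (1\<^sub>m ?N * ?g)) +
       kron pauli_Z (mat_adjoint ?g * (majorana zs0 * ?g))"
      unfolding k gate_at_Suc[OF Gc] zs(1) majorana.simps zs(2)
      by (simp only: conj_add[OF kg c] kron_lift_conj[OF gc pauli_carrier(2) one_carrier_mat]
          kron_lift_conj[OF gc pauli_carrier(1) Mc])
    also have "\<dots> = majorana (z # zs1)"
      unfolding zs1(2) conj_one[OF gc gate_at_unitary[OF assms(1) k']] by (simp add: zs1(1))
    finally show ?thesis using zs1(1) by (intro exI[of _ "z # zs1"]) simp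
  qed
qed simp

text \<open>The newest gate changes the observable before the older circuit acts, so the induction
  must range over all coefficient lists.\<close>

lemma circuit_conj_majorana:
  assumes "matchgate_circuit m U" "length zs = m"
  shows "\<exists>zs'. length zs' = m \<and> mat_adjoint U * (majorana zs * U) = majorana zs'"
  using assms
proof (induction arbitrary: zs rule: matchgate_circuit.induct)
  case empty
  show ?case
    using majorana_carrier'[OF empty] empty by (intro exI[of _ zs]) simp
next
  case (gate U G k)
  note g = gate_at_carrier[OF matchgate_carrier[OF gate.hyps(2)] gate.hyps(3)]
  note U = matchgate_circuit_carrier[OF gate.hyps(1)]
  obtain zs1 where zs1: "length zs1 = m"
      "mat_adjoint (gate_at m k G) * (majorana zs * gate_at m k G) = majorana zs1"
    using gate_conj_majorana[OF gate.hyps(2,3) gate.prems] by blast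
  obtain zs2 where "length zs2 = m" "mat_adjoint U * (majorana zs1 * U) = majorana zs2"
    using gate.IH[OF zs1(1)] by blast
  then show ?case
    using mult_conj_assoc[OF g U majorana_carrier'[OF gate.prems]] zs1(2) by auto
qed

lemma majorana_replicate_zero: "majorana (replicate n 0) = 0\<^sub>m (2 ^ n) (2 ^ n)"
proof (induction n)
  case (Suc n)
  have "equatorial 0 = 0\<^sub>m 2 2"
    unfolding equatorial_def by (rule eq_mat2I) auto
  with Suc show ?case by simp
qed simp

text \<open>This is Z = -i X Y on the first qubit; coefficient 1 encodes X, and -i encodes
  Y.\<close>

lemma first_Z_eq_majorana_mult:
  "first_Z (Suc n) = (- \<i>) \<cdot>\<^sub>m (majorana (1 # replicate n 0) * majorana (- \<i> # replicate n 0))"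
proof -
  have m: "majorana (z # replicate n 0) = kron (equatorial z) (1\<^sub>m (2 ^ n))" for z
    using kron_carrier[OF pauli_carrier(2)[of z] one_carrier_mat[of "2 ^ n"]]
    by (simp add: majorana_replicate_zero right_add_zero_mat)
  have "(- \<i>) \<cdot>\<^sub>m (equatorial 1 * equatorial (- \<i>)) = pauli_Z"
    unfolding pauli_mult mat2_smult by (simp add: pauli_Z_def)
  then show ?thesis
    unfolding m kron_mult[OF pauli_carrier(2,2) one_carrier_mat one_carrier_mat]
    by (simp add: first_Z_def flip: kron_smult_left)
qed

lemma circuit_weights:
  assumes U: "matchgate_circuit m U" and m: "1 \<le> m"
  shows "\<exists>w. (\<Sum>k<m. \<bar>w k\<bar>) \<le> 1 \<and> (\<forall>x. length x = m \<longrightarrow>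
    Re ((mat_adjoint U * (first_Z m * U)) $$ (basis_index x, basis_index x)) = (\<Sum>k<m. w k * spin (x ! k)))"
proof -
  obtain n where n: "m = Suc n" using m by (cases m) auto
  note Uc = matchgate_circuit_carrier[OF U]
  note UU = matchgate_circuit_unitary[OF U]
  have UU': "U * mat_adjoint U = 1\<^sub>m (2 ^ m)"
    by (rule mat_mult_left_right_inverse[OF mat_adjoint_carrier[OF Uc] Uc UU])
  \<comment> \<open>Conjugation preserves the square, a multiple of the identity whose factor is the
    squared norm and can be read off at one entry.\<close>
  have norm: "(\<Sum>z\<leftarrow>zs'. (cmod z)\<^sup>2) = 1"
    if "length zs = m" "(\<Sum>z\<leftarrow>zs. (cmod z)\<^sup>2) = 1" "length zs' = m"
      "mat_adjoint U * (majorana zs * U) = majorana zs'" for zs zs'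
  proof -
    note Mc = majorana_carrier'[OF that(1)]
    have "majorana zs' * majorana zs' = mat_adjoint U * ((majorana zs * majorana zs) * U)"
      unfolding that(4)[symmetric] by (rule mult_conj_mult[OF Uc Mc Mc UU', symmetric])
    also have "majorana zs * majorana zs = 1\<^sub>m (2 ^ m)"
      unfolding majorana_square that(1,2) by (intro eq_matI) simp_all
    finally have "majorana zs' * majorana zs' = 1\<^sub>m (2 ^ m)"
      unfolding conj_one[OF Uc UU] .
    then have "(of_real (\<Sum>z\<leftarrow>zs'. (cmod z)\<^sup>2) \<cdot>\<^sub>m 1\<^sub>m (2 ^ m)) $$ (0, 0) = (1\<^sub>m (2 ^ m) $$ (0, 0) :: complex)"
      unfolding majorana_square that(3) by simp
    then have "complex_of_real (\<Sum>z\<leftarrow>zs'. (cmod z)\<^sup>2) = 1" by simp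
    then show ?thesis by (simp only: of_real_eq_1_iff)
  qed
  have l: "length (z # replicate n 0) = m" for z :: complex by (simp add: n)
  obtain zs where zs: "length zs = m" "mat_adjoint U * (majorana (1 # replicate n 0) * U) = majorana zs"
    using circuit_conj_majorana[OF U l] by blast
  obtain ws where ws: "length ws = m" "mat_adjoint U * (majorana (- \<i> # replicate n 0) * U) = majorana ws"
    using circuit_conj_majorana[OF U l] by blast
  have norms: "(\<Sum>k<m. (cmod (zs ! k))\<^sup>2) = 1" "(\<Sum>k<m. (cmod (ws ! k))\<^sup>2) = 1"
    using norm[OF l _ zs] norm[OF l _ ws] zs(1) ws(1)
    by (simp_all add: sum_list_sum_nth[of "map _ zs"] sum_list_sum_nth[of "map _ ws"]
        sum_list_replicate lessThan_atLeast0)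
  define w where "w k = Im (zs ! k * cnj (ws ! k))" for k
  note Mc = majorana_carrier'[OF l]
  have "mat_adjoint U * (first_Z m * U) = (- \<i>) \<cdot>\<^sub>m (majorana zs * majorana ws)"
    unfolding n first_Z_eq_majorana_mult
    unfolding n[symmetric] conj_smult[OF Uc mult_carrier_mat[OF Mc Mc]] mult_conj_mult[OF Uc Mc Mc UU'] zs(2) ws(2) ..
  \<comment> \<open>The factor -i turns the imaginary parts tracked by \<open>majorana_diag\<close>
    into real parts.\<close>
  then have "Re ((mat_adjoint U * (first_Z m * U)) $$ (basis_index x, basis_index x)) = (\<Sum>k<m. w k * spin (x ! k))"
    if "length x = m" for x
    using that majorana_diag[OF zs(1) ws(1) that] majorana_carrier'[OF zs(1)] majorana_carrier'[OF ws(1)]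
    by (simp add: w_def del: index_mult_mat(1))
  moreover have "(\<Sum>k<m. \<bar>w k\<bar>) \<le> (\<Sum>k<m. ((cmod (zs ! k))\<^sup>2 + (cmod (ws ! k))\<^sup>2) / 2)"
  proof (rule sum_mono)
    fix k
    have "\<bar>w k\<bar> \<le> cmod (zs ! k) * cmod (ws ! k)"
      unfolding w_def using abs_Im_le_cmod[of "zs ! k * cnj (ws ! k)"] by (simp add: norm_mult)
    also have "\<dots> \<le> ((cmod (zs ! k))\<^sup>2 + (cmod (ws ! k))\<^sup>2) / 2"
      using sum_squares_bound[of "cmod (zs ! k)" "cmod (ws ! k)"] by simp
    finally show "\<bar>w k\<bar> \<le> ((cmod (zs ! k))\<^sup>2 + (cmod (ws ! k))\<^sup>2) / 2" .
  qed
  then have "(\<Sum>k<m. \<bar>w k\<bar>) \<le> 1"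
    by (simp add: sum_divide_distrib[symmetric] sum.distrib norms)
  ultimately show ?thesis by blast
qed

section \<open>Margins of linear threshold gates\<close>

lemma abs_spin [simp]: "\<bar>spin b\<bar> = 1"
  by (cases b) simp_all

lemma spin_mult_self [simp]: "spin b * spin b = 1"
  by (cases b) simp_all

lemma sgn_eq_spin_iff: "spin b = sgn a \<longleftrightarrow> 0 < spin b * a"
  by (cases b) (auto simp: sgn_if)

lemma ltg_representation_iff:
  "ltg_representation n f w \<theta> \<longleftrightarrow> (\<forall>x. length x = n \<longrightarrow> 0 < spin (f x) * affine_form n w \<theta> x)"
  by (simp add: ltg_representation_def sgn_eq_spin_iff)

lemma ltg_representation_abs:
  assumes "ltg_representation n f w \<theta>" "length x = n"
  shows "\<bar>affine_form n w \<theta> x\<bar> = spin (f x) * affine_form n w \<theta> x"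
  using assms abs_of_pos[of "spin (f x) * affine_form n w \<theta> x"]
  by (simp add: ltg_representation_iff abs_mult)

lemma ex_bool_list [simp]: "\<exists>x :: bool list. length x = n"
  by (rule exI[of _ "replicate n False"]) simp

lemma le_representation_margin_iff:
  "c \<le> representation_margin n w \<theta> \<longleftrightarrow> (\<forall>x. length x = n \<longrightarrow> c \<le> \<bar>affine_form n w \<theta> x\<bar>)"
  unfolding representation_margin_def by (subst Min_ge_iff) auto

text \<open>The form is nonzero at every bit string and bounded there by \<open>s\<close>; hence
  \<open>s\<close> is positive and rescaling is possible.\<close>

lemma ltg_representation_normalize:
  assumes rep: "ltg_representation n f w \<theta>"
  defines "s \<equiv> (\<Sum>k<n. \<bar>w k\<bar>) + \<bar>\<theta>\<bar>"
  shows "0 < s" "ltg_representation n f (\<lambda>k. w k / s) (\<theta> / s)" "normalized n (\<lambda>k. w k / s) (\<theta> / s)"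
    "affine_form n (\<lambda>k. w k / s) (\<theta> / s) x = affine_form n w \<theta> x / s"
proof -
  obtain y :: "bool list" where y: "length y = n" using Ex_list_of_length by blast
  have "0 < \<bar>affine_form n w \<theta> y\<bar>"
    using rep y by (auto simp: ltg_representation_iff)
  also have "\<dots> \<le> s"
  proof -
    have "\<bar>\<Sum>k<n. w k * spin (y ! k)\<bar> \<le> (\<Sum>k<n. \<bar>w k\<bar>)"
      using sum_abs[of "\<lambda>k. w k * spin (y ! k)" "{..<n}"] by (simp add: abs_mult)
    then show ?thesis unfolding s_def affine_form_def by linarith
  qed
  finally show s: "0 < s" .
  show aff: "affine_form n (\<lambda>k. w k / s) (\<theta> / s) x = affine_form n w \<theta> x / s" for x
    by (simp add: affine_form_def sum_divide_distrib add_divide_distrib)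
  show "ltg_representation n f (\<lambda>k. w k / s) (\<theta> / s)"
    using rep s by (simp add: ltg_representation_iff aff)
  have "(\<Sum>k<n. \<bar>w k / s\<bar>) + \<bar>\<theta> / s\<bar> = ((\<Sum>k<n. \<bar>w k\<bar>) + \<bar>\<theta>\<bar>) / s"
    using s by (simp add: abs_divide add_divide_distrib sum_divide_distrib)
  then show "normalized n (\<lambda>k. w k / s) (\<theta> / s)"
    using s by (simp add: normalized_def s_def)
qed

section \<open>Attainment of the maximal margin\<close>

lemma continuous_on_Min_image:
  fixes g :: "'a \<Rightarrow> 'b :: topological_space \<Rightarrow> real"
  assumes "finite A" "A \<noteq> {}" "\<And>a. a \<in> A \<Longrightarrow> continuous_on S (g a)"
  shows "continuous_on S (\<lambda>v. MIN a\<in>A. g a v)"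
  using assms
proof (induction rule: finite_ne_induct)
  case (insert a A)
  then have "continuous_on S (\<lambda>v. min (g a v) (MIN a\<in>A. g a v))"
    by (intro continuous_on_min) auto
  with insert.hyps show ?case by simp
qed simp

lemma continuous_on_coordinate [continuous_intros]:
  "continuous_on S (\<lambda>v :: 'a \<Rightarrow> 'b :: topological_space. v i)"
  by (rule continuous_on_subset[OF continuous_on_product_coordinates subset_UNIV])

text \<open>A closed condition inside a product of compact sets, so Tychonoff's theorem applies.
  Coordinates from \<open>m\<close> on are fixed at 0, since leaving them free would destroy
  compactness.\<close>

lemma compact_l1_sphere:
  "compact {v :: nat \<Rightarrow> real. (\<Sum>k<m. \<bar>v k\<bar>) = 1 \<and> (\<forall>k\<ge>m. v k = 0)}"
proof -
  let ?I = "\<lambda>k. if k < m then {-1..1} else {0} :: real set"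
  have "compactin (product_topology (\<lambda>i. euclidean) UNIV) (PiE UNIV ?I)"
    unfolding compactin_PiE by (auto simp: compactin_euclidean_iff)
  then have "compact (PiE UNIV ?I)"
    by (simp only: euclidean_product_topology compactin_euclidean_iff)
  moreover have "closed {v :: nat \<Rightarrow> real. (\<Sum>k<m. \<bar>v k\<bar>) = 1}"
    by (intro closed_Collect_eq continuous_intros)
  ultimately have "compact (PiE UNIV ?I \<inter> {v. (\<Sum>k<m. \<bar>v k\<bar>) = 1})"
    by (rule compact_Int_closed)
  moreover have "PiE UNIV ?I \<inter> {v. (\<Sum>k<m. \<bar>v k\<bar>) = 1} =
      {v. (\<Sum>k<m. \<bar>v k\<bar>) = 1 \<and> (\<forall>k\<ge>m. v k = 0)}" (is "?L = ?R")
  proof (intro equalityI subsetI)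
    fix v assume "v \<in> ?R"
    then have v: "(\<Sum>k<m. \<bar>v k\<bar>) = 1" "\<And>k. k \<ge> m \<Longrightarrow> v k = 0" by auto
    have "\<bar>v k\<bar> \<le> 1" if "k < m" for k
      unfolding v(1)[symmetric] by (rule member_le_sum) (use that in auto)
    with v show "v \<in> ?L" by (auto simp: PiE_iff abs_le_iff minus_le_iff)
  next
    fix v assume v: "v \<in> ?L"
    have "v k = 0" if "k \<ge> m" for k
      using v that by (auto simp: PiE_iff dest!: spec[of _ k])
    with v show "v \<in> ?R" by auto
  qed
  ultimately show ?thesis by simp
qed

text \<open>The threshold is stored as the coordinate \<open>n\<close> of the weight vector.\<close>

lemma ex_maximal_margin:
  assumes "is_ltg n f"
  shows "\<exists>w \<theta>. ltg_representation n f w \<theta> \<and> normalized n w \<theta> \<and>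
    (\<forall>w' \<theta>'. ltg_representation n f w' \<theta>' \<and> normalized n w' \<theta>' \<longrightarrow>
      representation_margin n w' \<theta>' \<le> representation_margin n w \<theta>)"
proof -
  let ?X = "{x :: bool list. length x = n}"
  let ?K = "{v :: nat \<Rightarrow> real. (\<Sum>k<Suc n. \<bar>v k\<bar>) = 1 \<and> (\<forall>k\<ge>Suc n. v k = 0)}"
  \<comment> \<open>The signed margin replaces the absolute value: it is continuous on the whole
    sphere and positive exactly at representations, so a maximizer is a representation as soon as
    one exists.\<close>
  define g where "g v = (MIN x\<in>?X. spin (f x) * affine_form n v (v n) x)" for v
  have margin: "g v = representation_margin n v (v n)" if "ltg_representation n f v (v n)" for v
    unfolding g_def representation_margin_def
    by (intro arg_cong[of _ _ Min] image_cong) (use ltg_representation_abs[OF that] in auto)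
  have encode: "\<exists>v\<in>?K. ltg_representation n f v (v n) \<and> representation_margin n v (v n) = representation_margin n w \<theta>"
    if "ltg_representation n f w \<theta>" "normalized n w \<theta>" for w \<theta>
  proof -
    define v where "v k = (if k < n then w k else if k = n then \<theta> else 0)" for k
    have aff: "affine_form n v (v n) x = affine_form n w \<theta> x" for x
      unfolding v_def by (simp add: affine_form_def)
    have "v \<in> ?K" using that(2) by (auto simp: normalized_def v_def)
    then show ?thesis
      using that(1) by (intro bexI[of _ v]) (simp_all add: ltg_representation_def representation_margin_def aff)
  qed
  from assms obtain w0 \<theta>0 where "ltg_representation n f w0 \<theta>0" by (auto simp: is_ltg_def)
  from encode[OF ltg_representation_normalize(2,3)[OF this]]
  obtain v0 where v0: "v0 \<in> ?K" "ltg_representation n f v0 (v0 n)" by blast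
  have "continuous_on ?K g"
    unfolding g_def affine_form_def by (intro continuous_on_Min_image continuous_intros) auto
  from continuous_attains_sup[OF compact_l1_sphere[of "Suc n"] _ this] v0(1)
  obtain v where v: "v \<in> ?K" "\<And>u. u \<in> ?K \<Longrightarrow> g u \<le> g v" by blast
  have "0 < g v0"
    unfolding g_def using v0(2) by (subst Min_gr_iff) (auto simp: ltg_representation_iff)
  then have "0 < g v" using v(2)[OF v0(1)] by linarith
  then have rep: "ltg_representation n f v (v n)"
    unfolding g_def by (subst (asm) Min_gr_iff) (auto simp: ltg_representation_iff)
  moreover have "normalized n v (v n)" using v(1) by (simp add: normalized_def)
  moreover have "representation_margin n w' \<theta>' \<le> representation_margin n v (v n)"
    if "ltg_representation n f w' \<theta>'" "normalized n w' \<theta>'" for w' \<theta>'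
  proof -
    from encode[OF that] obtain u where u: "u \<in> ?K" "ltg_representation n f u (u n)"
      "representation_margin n u (u n) = representation_margin n w' \<theta>'" by blast
    then show ?thesis using v(2)[OF u(1)] margin[OF rep] margin[OF u(2)] by linarith
  qed
  ultimately show ?thesis by blast
qed

text \<open>Because the maximum is attained, the greatest element in \<open>ltg_margin\<close> is
  well defined, and a lower bound on it amounts to a single witness.\<close>

lemma ltg_margin_ge_iff:
  "is_ltg n f \<and> c \<le> ltg_margin n f \<longleftrightarrow>
    (\<exists>w \<theta>. ltg_representation n f w \<theta> \<and> normalized n w \<theta> \<and> c \<le> representation_margin n w \<theta>)"
proof (cases "is_ltg n f")
  case True
  from ex_maximal_margin[OF this] obtain w \<theta> where w:
    "ltg_representation n f w \<theta>" "normalized n w \<theta>"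
    "\<And>w' \<theta>'. ltg_representation n f w' \<theta>' \<Longrightarrow> normalized n w' \<theta>' \<Longrightarrow>
      representation_margin n w' \<theta>' \<le> representation_margin n w \<theta>" by blast
  have "ltg_margin n f = representation_margin n w \<theta>"
    unfolding ltg_margin_def by (rule Greatest_equality) (use w in blast)+
  with True w show ?thesis by (metis order_trans)
next
  case False
  then show ?thesis by (auto simp: is_ltg_def)
qed

section \<open>From circuits to representations and back\<close>

lemma circuit_representation:
  assumes U: "matchgate_circuit m U" and mn: "n \<le> m" "1 \<le> m" and p: "1 / 2 < p"
    and comp: "computes_with_prob n m U f p"
  shows "\<exists>w \<theta>. ltg_representation n f w \<theta> \<and> normalized n w \<theta> \<and> 2 * p - 1 \<le> representation_margin n w \<theta>"
proof -
  obtain v where v: "(\<Sum>k<m. \<bar>v k\<bar>) \<le> 1" "\<And>x. length x = m \<Longrightarrow>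
      Re ((mat_adjoint U * (first_Z m * U)) $$ (basis_index x, basis_index x)) = (\<Sum>k<m. v k * spin (x ! k))"
    using circuit_weights[OF U mn(2)] by blast
  \<comment> \<open>The ancillas start in state 0 and have spin 1, so their weights merge into a
    constant; it is 0 if \<open>m = n\<close>.\<close>
  define \<theta> where "\<theta> = (\<Sum>k = n..<m. v k)"
  define s where "s = (\<Sum>k<n. \<bar>v k\<bar>) + \<bar>\<theta>\<bar>"
  have un: "{..<m} = {..<n} \<union> {n..<m}" using mn by auto
  have split: "(\<Sum>k<m. h k) = (\<Sum>k<n. h k) + (\<Sum>k = n..<m. h k)" for h :: "nat \<Rightarrow> real"
    unfolding un by (rule sum.union_disjoint) auto
  have bound: "2 * p - 1 \<le> spin (f x) * affine_form n v \<theta> x" if x: "length x = n" for x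
  proof -
    let ?x = "x @ replicate (m - n) False"
    have len: "length ?x = m" using x mn by simp
    have "p \<le> prob_first_qubit m (U *\<^sub>v ket ?x) (f x)"
      using comp x by (simp add: computes_with_prob_def)
    also have "\<dots> = (1 + spin (f x) * (\<Sum>k<m. v k * spin (?x ! k))) / 2"
      unfolding prob_first_qubit_eq[OF matchgate_circuit_carrier[OF U] matchgate_circuit_unitary[OF U] mn(2) len] v(2)[OF len] ..
    also have "(\<Sum>k<m. v k * spin (?x ! k)) = affine_form n v \<theta> x"
    proof -
      have "(\<Sum>k = n..<m. v k * spin (?x ! k)) = \<theta>"
        unfolding \<theta>_def by (rule sum.cong) (auto simp: nth_append x diff_less_mono)
      then show ?thesis unfolding split affine_form_def by (simp add: nth_append x)
    qed
    finally show ?thesis by simp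
  qed
  have rep: "ltg_representation n f v \<theta>"
    unfolding ltg_representation_iff
  proof (intro allI impI)
    show "0 < spin (f x) * affine_form n v \<theta> x" if "length x = n" for x
      using bound[OF that] p by linarith
  qed
  note norm = ltg_representation_normalize[OF rep, folded s_def]
  \<comment> \<open>Merging the ancilla weights cannot increase the norm, so normalization divides
    by some \<open>s\<close> between 0 and 1 and cannot lower the margin.\<close>
  have "s \<le> (\<Sum>k<n. \<bar>v k\<bar>) + (\<Sum>k = n..<m. \<bar>v k\<bar>)"
    unfolding s_def \<theta>_def using sum_abs[of v "{n..<m}"] by simp
  then have s1: "s \<le> 1" using v(1) unfolding split by simp
  have "2 * p - 1 \<le> \<bar>affine_form n (\<lambda>k. v k / s) (\<theta> / s) x\<bar>" if x: "length x = n" for x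
  proof -
    have "2 * p - 1 \<le> \<bar>affine_form n v \<theta> x\<bar>"
      using bound[OF x] ltg_representation_abs[OF rep x] by simp
    also have "\<dots> \<le> \<bar>affine_form n v \<theta> x\<bar> / s"
      using s1 norm(1) by (simp add: pos_le_divide_eq mult_left_le)
    finally show ?thesis using norm(1) by (simp add: norm(4))
  qed
  with norm(2,3) show ?thesis
    unfolding le_representation_margin_iff by blast
qed

lemma representation_circuit:
  assumes "1 \<le> n" "ltg_representation n f w \<theta>" "normalized n w \<theta>" "2 * p - 1 \<le> representation_margin n w \<theta>"
  shows "\<exists>U. matchgate_circuit (n + 1) U \<and> computes_with_prob n (n + 1) U f p"
proof -
  \<comment> \<open>Index \<open>n\<close> is the ancilla, whose constant spin 1 makes its weight
    the threshold.\<close>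
  define v where "v k = (if k < n then w k else \<theta>)" for k
  have "(\<Sum>k<n + 1. \<bar>v k\<bar>) \<le> 1" using assms(3) by (simp add: v_def normalized_def)
  then obtain U where U: "matchgate_circuit (n + 1) U" "\<And>x. length x = n + 1 \<Longrightarrow>
    (mat_adjoint U * (first_Z (n + 1) * U)) $$ (basis_index x, basis_index x) =
      of_real (\<Sum>k<n + 1. v k * spin (x ! k))"
    using ex_circuit_with_weights[of "n + 1" v] assms(1) by auto
  have "p \<le> prob_first_qubit (n + 1) (U *\<^sub>v ket (x @ replicate (n + 1 - n) False)) (f x)"
    if x: "length x = n" for x
  proof -
    let ?x = "x @ replicate (n + 1 - n) False"
    have len: "length ?x = n + 1" using x by simp
    have "(\<Sum>k<n + 1. v k * spin (?x ! k)) = affine_form n w \<theta> x"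
      by (simp add: v_def affine_form_def nth_append x)
    then have "prob_first_qubit (n + 1) (U *\<^sub>v ket ?x) (f x) = (1 + spin (f x) * affine_form n w \<theta> x) / 2"
      by (simp only: prob_first_qubit_eq[OF matchgate_circuit_carrier[OF U(1)]
            matchgate_circuit_unitary[OF U(1)] le_add2 len] U(2)[OF len] Re_complex_of_real)
    moreover have "2 * p - 1 \<le> spin (f x) * affine_form n w \<theta> x"
      using assms(4) x ltg_representation_abs[OF assms(2) x] unfolding le_representation_margin_iff by metis
    ultimately show ?thesis by simp
  qed
  with U(1) show ?thesis unfolding computes_with_prob_def by blast
qed

theorem theorem1:
  fixes n :: nat and f :: "bool list \<Rightarrow> bool" and p :: real
  assumes "n \<ge> 1" and "1 / 2 < p" and "p \<le> 1"
  shows "(matchgate_computable n f p \<longleftrightarrow> is_ltg n f \<and> ltg_margin n f \<ge> 2 * p - 1) \<and>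
    (matchgate_computable n f p \<longleftrightarrow>
      (\<exists>m U. n \<le> m \<and> m \<le> n + 1 \<and> matchgate_circuit m U \<and> computes_with_prob n m U f p))"
proof -
  let ?small = "\<exists>m U. n \<le> m \<and> m \<le> n + 1 \<and> matchgate_circuit m U \<and> computes_with_prob n m U f p"
  let ?ltg = "is_ltg n f \<and> ltg_margin n f \<ge> 2 * p - 1"
  \<comment> \<open>A cycle of implications: computability gives a margin, a margin gives a small
    circuit, and a small circuit is an instance of computability.\<close>
  have "?ltg" if "matchgate_computable n f p"
    using that circuit_representation[OF _ _ _ assms(2)] assms(1)
    unfolding matchgate_computable_def ltg_margin_ge_iff by (meson order_trans)
  moreover have "?small" if ltg: "?ltg"
  proof -
    obtain w \<theta> where "ltg_representation n f w \<theta>" "normalized n w \<theta>" "2 * p - 1 \<le> representation_margin n w \<theta>"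
      using ltg unfolding ltg_margin_ge_iff by blast
    from representation_circuit[OF assms(1) this] show ?thesis by (meson le_add1 order_refl)
  qed
  moreover have "matchgate_computable n f p" if "?small"
    using that unfolding matchgate_computable_def by blast
  ultimately show ?thesis by blast
qed

end
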